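(* Let $x\sim\mathcal{N}(\mu,\Sigma)$ be a Gaussian signal in $\mathbb{R}^n$ with known $\mu$ and known covariance matrix $\Sigma$ of rank $k\le n$, and let $\lambda_1,\dots,\lambda_k$ be the (non-zero) eigenvalues of $\Sigma$ with multiplicities. Let $\varepsilon>0$ be the accuracy, $p\in(0,1)$, and let the measurements be subject to white Gaussian noise added prior to the measurement, so that a measurement with a unit vector $a_i$ returns $y_i=a_i^{\intercal}x+w_i$ with $w_i\sim\mathcal{N}(0,\sigma^2)$. Then the Info-Greedy Sensing algorithm described in the context returns $\widehat{x}$ satisfying $\|x-\widehat{x}\|_2<\varepsilon$ with probability at least $p$, using at most the following number of measurements by unit vectors $\|a_i\|_2=1$: $$m=\sum_{\substack{i=1\\ \lambda_i\neq0}}^{k}\max\left\{0,\left\lceil\left(\frac{\chi_n^2(p)}{\varepsilon^2}-\frac{1}{\lambda_i}\right)\sigma^2\right\rceil\right\}$$ provided $\sigma>0$. If $\sigma^2\le\varepsilon^2/\chi_n^2(p)$, the number of measurements simplifies to $$\left|\left\{i:\lambda_i>\frac{\varepsilon^2}{\chi_n^2(p)}\right\}\right|.$$ This also holds when $\sigma=0$.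
   Context: $\chi_n^2(\cdot)$ denotes the quantile function of the chi-squared distribution with $n$ degrees of freedom, and $\|\Sigma\|$ is the largest eigenvalue of the covariance matrix $\Sigma$. Noise model ("noise folding", white noise added prior to measurement): a measurement with vector $a$ returns $a^{\intercal}(x+w)$ with $w\sim\mathcal{N}(0,\sigma^2I)$, with fresh noise, independent of $x$ and of the other measurements, for every measurement; for $\|a\|_2=1$ this is $a^{\intercal}x+w_i$ with $w_i\sim\mathcal{N}(0,\sigma^2)$. Info-Greedy Sensing algorithm for this model: as long as $\|\Sigma\|>\varepsilon^2/\chi_n^2(p)$, repeat: let $a$ be a unit eigenvector of the current $\Sigma$ for its largest eigenvalue; measure with $a$ to obtain $y$; update $\mu\leftarrow\mu+\Sigma a(a^{\intercal}\Sigma a+\sigma^2)^{-1}(y-a^{\intercal}\mu)$ and $\Sigma\leftarrow\Sigma-\Sigma a(a^{\intercal}\Sigma a+\sigma^2)^{-1}a^{\intercal}\Sigma$ (both updates computed from the old $\mu,\Sigma$). When $\|\Sigma\|\le\varepsilon^2/\chi_n^2(p)$, return $\widehat{x}=\mu$ (the posterior mean). *)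

theory Defs
  imports "HOL-Probability.Probability"
begin

definition eigenspace :: "real^'n^'n \<Rightarrow> real \<Rightarrow> (real^'n) set" where
  "eigenspace A l = {v. A *v v = l *\<^sub>R v}"

definition eigenvalues :: "real^'n^'n \<Rightarrow> real set" where
  "eigenvalues A = {l. \<exists>v\<in>eigenspace A l. v \<noteq> 0}"

definition largest_eigenvalue :: "real^'n^'n \<Rightarrow> real" where
  "largest_eigenvalue A = Max (eigenvalues A)"

text \<open>
  For a symmetric matrix the algebraic and the geometric multiplicity of an eigenvalue agree,
  so the multiplicity is taken to be the dimension of the eigenspace.
\<close>

definition nonzero_eigenvalues_with_mult :: "real^'n^'n \<Rightarrow> nat \<Rightarrow> (nat \<Rightarrow> real) \<Rightarrow> bool" where
  "nonzero_eigenvalues_with_mult A k lam \<longleftrightarrow>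
     (\<forall>i\<in>{1..k}. lam i \<noteq> 0) \<and>
     (\<forall>l. l \<noteq> 0 \<longrightarrow> card {i\<in>{1..k}. lam i = l} = dim (eigenspace A l))"

definition chi_squared :: "nat \<Rightarrow> real measure" where
  "chi_squared n =
     distr (\<Pi>\<^sub>M i\<in>{..<n}. std_normal_distribution) borel (\<lambda>z. \<Sum>i<n. (z i)\<^sup>2)"

definition quantile :: "real measure \<Rightarrow> real \<Rightarrow> real" where
  "quantile D p = Inf {q. p \<le> cdf D q}"

text \<open>
  The law of \<open>m + A Z\<close> for \<open>Z\<close> with independent standard normal entries. A random vector is
  normal with mean \<open>m\<close> and covariance \<open>S\<close> if it has this law for some \<open>A\<close> with
  \<open>S = A A\<^sup>T\<close>; singular covariance matrices (in particular \<open>0\<close>) are allowed.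
\<close>

definition affine_std_normal :: "real^'n \<Rightarrow> real^'n^'n \<Rightarrow> (real^'n) measure" where
  "affine_std_normal m A =
     distr (\<Pi>\<^sub>M i\<in>(UNIV :: 'n set). std_normal_distribution) borel (\<lambda>z. m + A *v (\<chi> i. z i))"

definition normal_vector ::
    "'a measure \<Rightarrow> ('a \<Rightarrow> real^'n) \<Rightarrow> real^'n \<Rightarrow> real^'n^'n \<Rightarrow> bool" where
  "normal_vector M X m S \<longleftrightarrow> X \<in> borel_measurable M \<and>
     (\<exists>A. S = A ** transpose A \<and> distr M borel X = affine_std_normal m A)"

text \<open>
  The iterates of the algorithm: \<open>d i\<close> is the direction and \<open>y i\<close> the outcome of the measurement
  made in iteration \<open>i\<close> (counted from 0), and \<open>i\<close> measurements have been made when the current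
  mean and covariance are \<open>ig_mean \<sigma> m S d y i\<close> and \<open>ig_cov \<sigma> S d i\<close>.
\<close>

primrec ig_cov :: "real \<Rightarrow> real^'n^'n \<Rightarrow> (nat \<Rightarrow> real^'n) \<Rightarrow> nat \<Rightarrow> real^'n^'n" where
  "ig_cov \<sigma> S d 0 = S"
| "ig_cov \<sigma> S d (Suc i) =
     (let C = ig_cov \<sigma> S d i; a = d i in
      C - inverse (a \<bullet> (C *v a) + \<sigma>\<^sup>2) *\<^sub>R
          ((columnvector (C *v a) :: real^1^'n) ** (rowvector (a v* C) :: real^'n^1)))"

primrec ig_mean ::
    "real \<Rightarrow> real^'n \<Rightarrow> real^'n^'n \<Rightarrow> (nat \<Rightarrow> real^'n) \<Rightarrow> (nat \<Rightarrow> real) \<Rightarrow> nat \<Rightarrow> real^'n" where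
  "ig_mean \<sigma> m S d y 0 = m"
| "ig_mean \<sigma> m S d y (Suc i) =
     (let C = ig_cov \<sigma> S d i; u = ig_mean \<sigma> m S d y i; a = d i in
      u + (inverse (a \<bullet> (C *v a) + \<sigma>\<^sup>2) * (y i - a \<bullet> u)) *\<^sub>R (C *v a))"

text \<open>
  The algorithm leaves the choice among the unit eigenvectors for the largest eigenvalue open.
  \<open>ig_directions\<close> holds of every sequence of admissible choices; it constrains \<open>d i\<close> only if
  iteration \<open>i\<close> is reached.
\<close>

definition ig_directions ::
    "real \<Rightarrow> real \<Rightarrow> real^'n^'n \<Rightarrow> (nat \<Rightarrow> real^'n) \<Rightarrow> bool" where
  "ig_directions \<sigma> thr S d \<longleftrightarrow>
     (\<forall>i. (\<forall>j\<le>i. largest_eigenvalue (ig_cov \<sigma> S d j) > thr) \<longrightarrow>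
        norm (d i) = 1 \<and> d i \<in> eigenspace (ig_cov \<sigma> S d i) (largest_eigenvalue (ig_cov \<sigma> S d i)))"

definition ig_stops_after ::
    "real \<Rightarrow> real \<Rightarrow> real^'n^'n \<Rightarrow> (nat \<Rightarrow> real^'n) \<Rightarrow> nat \<Rightarrow> bool" where
  "ig_stops_after \<sigma> thr S d N \<longleftrightarrow>
     (\<forall>j<N. largest_eigenvalue (ig_cov \<sigma> S d j) > thr) \<and>
     largest_eigenvalue (ig_cov \<sigma> S d N) \<le> thr"

end

(* The error e of the posterior mean after i measurements is a centred Gaussian vector with
   covariance C, the current covariance of the algorithm: each update sends e to
   (I - K a^T) e - (a . w) K with fresh noise w, and the result is again Gaussian because the
   standard Gaussian law is invariant under rotations.  When the algorithm stops, e has the law of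
   B z with z standard normal and |B z|^2 <= (eps^2 / c) |z|^2, so |e| < eps whenever |z|^2 < c,
   an event of probability at least p since the chi-squared law has no atoms.

   For the number of measurements, a measurement along a top eigenvector replaces one
   eigenvalue l by l s^2 / (l + s^2) and keeps the others.  Summing over the eigenvalues either
   max 0 (ceiling ((c / eps^2 - 1 / l) s^2)) or, if s^2 <= eps^2 / c, the indicator of
   l > eps^2 / c gives a nonnegative integer that drops by exactly one in each iteration. *)
theory Submission
  imports Defs
begin

text \<open>Covariances and directions never depend on the outcomes, so the stopping index
  \<open>N\<close> is the same for every \<omega>. The error after \<open>i\<close> measurements is
  therefore a fixed measurable function of \<open>x\<close> and the first \<open>i\<close> noise
  vectors, and is independent of \<open>w i\<close>. The obstacle is that covariances may be
  singular: Gaussian vectors need not have densities and are handled as images \<open>B *v z\<close>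
  of a standard Gaussian, for some \<open>B\<close> with \<open>B ** transpose B\<close> equal to
  the covariance. An update adds one independent scalar, which gives an image of
  \<open>n + 1\<close> standard coordinates in dimension \<open>n\<close>. Rotation invariance
  brings this back to a square factor, and it also shows that a linear functional of a Gaussian
  vector is a scaled standard normal. Two integer counts are required. For \<sigma> = 0 the ceiling
  is 0 throughout and cannot drop, so the indicator has to prove termination; when \<sigma>^2
  exceeds the threshold, one eigenvalue may take several measurements, which the ceiling
  counts.\<close>

subsection \<open>Rotation invariance of the standard Gaussian law\<close>

text \<open>The library proves that orthogonal maps preserve Lebesgue measure only for well-ordered index
  types, so an arbitrary finite index type is first replaced by a well-ordered copy.\<close>

typedef (overloaded) 'a index_copy = "{..<CARD('a::finite)}"
  by (rule exI[of _ 0]) simp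

instantiation index_copy :: (finite) wellorder
begin

definition "x \<le> y \<longleftrightarrow> Rep_index_copy x \<le> Rep_index_copy y"
definition "x < y \<longleftrightarrow> Rep_index_copy x < Rep_index_copy y"

instance
proof
  fix P :: "'a index_copy \<Rightarrow> bool" and a
  assume step: "\<And>x. (\<And>y. y < x \<Longrightarrow> P y) \<Longrightarrow> P x"
  show "P a"
  proof (induction "Rep_index_copy a" arbitrary: a rule: less_induct)
    case less
    show ?case by (rule step) (rule less, simp add: less_index_copy_def)
  qed
qed (auto simp: less_eq_index_copy_def less_index_copy_def Rep_index_copy_inject)

end

lemma bij_betw_Rep_index_copy:
  "bij_betw (Rep_index_copy :: 'a::finite index_copy \<Rightarrow> nat) UNIV {..<CARD('a)}"
  by (simp add: bij_betw_def type_definition.Rep_range[OF type_definition_index_copy]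
      inj_on_def Rep_index_copy_inject)

instance index_copy :: (finite) finite
proof
  show "finite (UNIV :: 'a index_copy set)"
    using bij_betw_finite[OF bij_betw_Rep_index_copy[where 'a='a]] by simp
qed

lemma ex_bij_index_copy: "\<exists>h :: 'a::finite \<Rightarrow> 'a index_copy. bij h"
proof -
  have "CARD('a index_copy) = CARD('a)"
    using bij_betw_same_card[OF bij_betw_Rep_index_copy[where 'a='a]] by simp
  then show ?thesis
    by (intro finite_same_card_bij) simp_all
qed

section \<open>The standard Gaussian law as a measure on vectors\<close>

definition std_gauss :: "(real^'n) measure" where
  "std_gauss = distr (\<Pi>\<^sub>M i\<in>(UNIV :: 'n set). std_normal_distribution) borel (\<lambda>z. \<chi> i. z i)"

lemma prob_space_std_normal_distribution: "prob_space std_normal_distribution"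
  using real_dist_normal_dist real_distribution_def by blast

lemma borel_measurable_vec_iff:
  "f \<in> borel_measurable M \<longleftrightarrow> (\<forall>i. (\<lambda>x. f x $ i) \<in> borel_measurable M)"
  for f :: "'a \<Rightarrow> real^'n"
  by (subst borel_measurable_euclidean_space) (auto simp: Basis_vec_def inner_axis)

lemma measurable_vec_nth [measurable (raw)]:
  "f \<in> borel_measurable M \<Longrightarrow> (\<lambda>x. f x $ i) \<in> borel_measurable M"
  for f :: "'a \<Rightarrow> real^'n"
  by (simp add: borel_measurable_vec_iff)

lemma measurable_vec_lambda [measurable (raw)]:
  "(\<And>i. (\<lambda>x. f x i) \<in> borel_measurable M) \<Longrightarrow> (\<lambda>x. (\<chi> i. f x i) :: real^'n) \<in> borel_measurable M"
  by (simp add: borel_measurable_vec_iff)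

lemma measurable_matrix_vector_mult [measurable (raw)]:
  "f \<in> borel_measurable M \<Longrightarrow> (\<lambda>x. A *v f x) \<in> borel_measurable M"
  for f :: "'a \<Rightarrow> real^'n" and A :: "real^'n^'m"
  unfolding matrix_vector_mult_def by measurable

lemma sets_std_gauss [measurable_cong, simp]: "sets std_gauss = sets borel"
  by (simp add: std_gauss_def)

lemma space_std_gauss [simp]: "space std_gauss = UNIV"
  by (simp add: std_gauss_def)

lemma prob_space_std_gauss: "prob_space std_gauss"
  unfolding std_gauss_def
  by (intro prob_space.prob_space_distr prob_space_PiM prob_space_std_normal_distribution) measurable

lemma affine_std_normal_eq_distr:
  "affine_std_normal m A = distr std_gauss borel (\<lambda>z. m + A *v z)"
  unfolding affine_std_normal_def std_gauss_def
  by (subst distr_distr) (auto simp: o_def)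

text \<open>A bijective \<open>h\<close> relabels the coordinates; \<open>h = Some\<close> discards
  one coordinate, so that a marginal is again standard Gaussian. Both cases are used.\<close>

lemma std_gauss_reindex:
  fixes h :: "'m::finite \<Rightarrow> 'k::finite"
  assumes "inj h"
  shows "distr std_gauss borel (\<lambda>z :: real^'k. \<chi> i. z $ h i) = std_gauss"
proof -
  let ?N = "std_normal_distribution"
  have "distr (std_gauss :: (real^'k) measure) borel (\<lambda>z. \<chi> i. z $ h i)
      = distr (\<Pi>\<^sub>M i\<in>UNIV. ?N) borel (\<lambda>z. \<chi> i. z (h i))"
    unfolding std_gauss_def by (subst distr_distr) (auto simp: o_def)
  also have "\<dots> = distr (distr (\<Pi>\<^sub>M i\<in>UNIV. ?N) (\<Pi>\<^sub>M i\<in>UNIV. ?N) (\<lambda>\<omega>. \<lambda>n\<in>UNIV. \<omega> (h n)))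
      borel (\<lambda>z. \<chi> i. z i)"
    by (subst distr_distr) (auto simp: o_def restrict_UNIV intro!: measurable_PiM_single')
  also have "\<dots> = std_gauss"
    unfolding std_gauss_def
    by (subst distr_PiM_reindex) (use assms in \<open>auto simp: prob_space_std_normal_distribution\<close>)
  finally show ?thesis .
qed

lemma borel_measurable_orthogonal_transformation:
  fixes f :: "'a::euclidean_space \<Rightarrow> 'a"
  assumes "orthogonal_transformation f"
  shows "f \<in> borel_measurable borel"
  using orthogonal_transformation_linear[OF assms]
  by (intro borel_measurable_continuous_onI linear_continuous_on)
    (simp add: linear_conv_bounded_linear)

lemma prod_Basis_vec: "(\<Prod>b\<in>Basis. F b) = (\<Prod>i\<in>UNIV. F (axis i 1 :: real^'m))"
proof -
  have B: "Basis = range (\<lambda>i::'m. axis i (1::real))" by (auto simp: Basis_vec_def)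
  have I: "inj (\<lambda>i::'m. axis i (1::real))" by (auto simp: inj_on_def axis_eq_axis)
  show ?thesis
    unfolding B by (simp add: prod.reindex[OF I])
qed

text \<open>Lebesgue measure is determined by its values on open boxes, and the preimage of a box
  under \<open>f\<close> is its image under the orthogonal map \<open>inv f\<close>, which has the
  same volume.\<close>

lemma distr_lborel_orthogonal:
  fixes f :: "real^'m::{finite,wellorder} \<Rightarrow> real^'m::_"
  assumes f: "orthogonal_transformation f"
  shows "distr lborel borel f = lborel"
proof (rule lborel_eqI[symmetric])
  fix l u :: "real^'m::_"
  assume lu: "\<And>b. b \<in> Basis \<Longrightarrow> l \<bullet> b \<le> u \<bullet> b"
  have g: "orthogonal_transformation (inv f)"
    by (rule orthogonal_transformation_inv[OF f])
  note [measurable] = borel_measurable_orthogonal_transformation[OF f]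
  have pre: "f -` box l u = inv f ` box l u"
    using orthogonal_transformation_bij[OF f] by (simp add: bij_vimage_eq_inv_image)
  have box: "box l u \<in> lmeasurable"
    by simp
  have "emeasure (distr lborel borel f) (box l u) = emeasure lborel (f -` box l u)"
    by (simp add: emeasure_distr)
  also have "\<dots> = emeasure lebesgue (f -` box l u)"
  proof -
    have "f -` box l u \<in> sets lborel"
      using measurable_sets_borel[OF \<open>f \<in> borel_measurable borel\<close>, of "box l u"] by simp
    then show ?thesis by simp
  qed
  also have "\<dots> = ennreal (measure lebesgue (inv f ` box l u))"
    unfolding pre by (rule emeasure_eq_measure2) (use measurable_orthogonal_image[OF g box] in auto)
  also have "\<dots> = ennreal (measure lebesgue (box l u))"
    by (simp only: measure_orthogonal_image[OF g box])
  also have "\<dots> = (\<Prod>b\<in>Basis. (u - l) \<bullet> b)"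
    using lu by (simp add: measure_completion measure_lborel_box_eq)
  finally show "emeasure (distr lborel borel f) (box l u) = (\<Prod>b\<in>Basis. (u - l) \<bullet> b)" .
qed simp

lemma std_gauss_eq_density:
  "(std_gauss :: (real^'m) measure) = density lborel (\<lambda>x. \<Prod>i\<in>UNIV. ennreal (std_normal_density (x $ i)))"
proof -
  let ?N = "std_normal_distribution" and ?f = "\<lambda>x::real^'m. \<Prod>i\<in>UNIV. ennreal (std_normal_density (x $ i))"
  interpret product_sigma_finite "\<lambda>_::'m. ?N"
    unfolding product_sigma_finite_def
    by (intro allI prob_space_imp_sigma_finite prob_space_std_normal_distribution)
  have "distr (density lborel ?f) (\<Pi>\<^sub>M i\<in>UNIV. ?N) (\<lambda>x i. x $ i) = (\<Pi>\<^sub>M i\<in>UNIV. ?N)"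
  proof (rule PiM_eqI)
    fix A :: "'m \<Rightarrow> real set"
    assume "\<And>i. i \<in> UNIV \<Longrightarrow> A i \<in> sets ?N"
    then have A [measurable]: "\<And>i. A i \<in> sets borel" by simp
    \<comment> \<open>The product rule for integrals over \<open>lborel\<close> is indexed by
      \<open>Basis\<close>; \<open>?A\<close> recovers the coordinate from its basis vector,
      uniquely because distinct coordinates have distinct axes.\<close>
    let ?A = "\<lambda>b::real^'m. A (SOME i. b = axis i 1)"
    have index: "(SOME j. axis i 1 = axis j (1::real)) = i" for i :: 'm
      by (auto simp: axis_eq_axis)
    have [measurable]: "(\<lambda>x i. x $ i) \<in> density lborel ?f \<rightarrow>\<^sub>M (\<Pi>\<^sub>M i\<in>UNIV. ?N)"
      by (rule measurable_PiM_single') auto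
    have "emeasure (distr (density lborel ?f) (\<Pi>\<^sub>M i\<in>UNIV. ?N) (\<lambda>x i. x $ i)) (Pi\<^sub>E UNIV A)
        = emeasure (density lborel ?f) {x. \<forall>i. x $ i \<in> A i}"
    proof (subst emeasure_distr)
      show "Pi\<^sub>E UNIV A \<in> sets (\<Pi>\<^sub>M i\<in>UNIV. ?N)"
        by (rule sets_PiM_I_finite) auto
    qed (auto simp: PiE_def Pi_def vimage_def)
    also have "\<dots> = (\<integral>\<^sup>+x. ?f x * indicator {x. \<forall>i. x $ i \<in> A i} x \<partial>lborel)"
    proof (rule emeasure_density)
      have "{x::real^'m. \<forall>i. x $ i \<in> A i} = (\<Inter>i\<in>UNIV. (\<lambda>x. x $ i) -` A i)"
        by auto
      also have "\<dots> \<in> sets borel"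
        by (intro sets.finite_INT measurable_sets_borel[where M=borel]) auto
      finally show "{x::real^'m. \<forall>i. x $ i \<in> A i} \<in> sets lborel" by simp
    qed simp
    also have "\<dots> = (\<integral>\<^sup>+x. (\<Prod>i\<in>UNIV. ennreal (std_normal_density (x $ i)) * indicator (A i) (x $ i)) \<partial>lborel)"
    proof (rule nn_integral_cong)
      fix x :: "real^'m"
      have "indicator {x. \<forall>i. x $ i \<in> A i} x = (\<Prod>i\<in>UNIV. indicator (A i) (x $ i) :: ennreal)"
      proof (cases "\<forall>i. x $ i \<in> A i")
        case False
        then obtain i where "x $ i \<notin> A i" by blast
        then have "(\<Prod>i\<in>UNIV. indicator (A i) (x $ i) :: ennreal) = 0"
          by (intro prod_zero bexI[of _ i]) auto
        with False show ?thesis by simp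
      qed simp
      then show "?f x * indicator {x. \<forall>i. x $ i \<in> A i} x
        = (\<Prod>i\<in>UNIV. ennreal (std_normal_density (x $ i)) * indicator (A i) (x $ i))"
        by (simp add: prod.distrib)
    qed
    also have "\<dots> = (\<integral>\<^sup>+x. (\<Prod>b\<in>Basis. ennreal (std_normal_density (x \<bullet> b)) * indicator (?A b) (x \<bullet> b)) \<partial>lborel)"
      by (simp add: prod_Basis_vec index inner_axis)
    also have "\<dots> = (\<Prod>b\<in>Basis. \<integral>\<^sup>+x. ennreal (std_normal_density x) * indicator (?A b) x \<partial>lborel)"
      by (rule nn_integral_lborel_prod) auto
    also have "\<dots> = (\<Prod>i\<in>UNIV. \<integral>\<^sup>+x. ennreal (std_normal_density x) * indicator (A i) x \<partial>lborel)"
      by (simp add: prod_Basis_vec index)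
    also have "\<dots> = (\<Prod>i\<in>UNIV. emeasure ?N (A i))"
      by (simp add: emeasure_density)
    finally show "emeasure (distr (density lborel ?f) (\<Pi>\<^sub>M i\<in>UNIV. ?N) (\<lambda>x i. x $ i)) (Pi\<^sub>E UNIV A)
        = (\<Prod>i\<in>UNIV. emeasure ?N (A i))" .
  qed simp_all
  then have "std_gauss = distr (distr (density lborel ?f) (\<Pi>\<^sub>M i\<in>UNIV. ?N) (\<lambda>x i. x $ i)) borel (\<lambda>z. \<chi> i. z i)"
    by (simp add: std_gauss_def)
  also have "\<dots> = distr (density lborel ?f) borel (\<lambda>x. x)"
    by (subst distr_distr) (auto simp: o_def intro!: measurable_PiM_single')
  also have "\<dots> = density lborel ?f"
    by (rule distr_id2) simp
  finally show ?thesis .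
qed

text \<open>The density sees \<open>x\<close> only through its norm; this is the source of the
  rotation invariance.\<close>

lemma prod_std_normal_density:
  "(\<Prod>i\<in>UNIV. ennreal (std_normal_density (x $ i)))
    = ennreal ((1 / sqrt (2 * pi)) ^ CARD('m) * exp (- (norm x)\<^sup>2 / 2))" for x :: "real^'m"
proof -
  have "(norm x)\<^sup>2 = (\<Sum>i\<in>UNIV. (x $ i)\<^sup>2)"
    by (simp add: norm_vec_def L2_set_def sum_nonneg)
  then have "(\<Prod>i\<in>UNIV. exp (- (x $ i)\<^sup>2 / 2)) = exp (- (norm x)\<^sup>2 / 2)"
    by (simp only: exp_sum[symmetric, OF finite] sum_divide_distrib[symmetric] sum_negf)
  then have "(\<Prod>i\<in>UNIV. std_normal_density (x $ i))
      = (1 / sqrt (2 * pi)) ^ CARD('m) * exp (- (norm x)\<^sup>2 / 2)"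
    by (simp only: std_normal_density_def prod.distrib prod_constant)
  moreover have "(\<Prod>i\<in>UNIV. ennreal (std_normal_density (x $ i)))
      = ennreal (\<Prod>i\<in>UNIV. std_normal_density (x $ i))"
    by (rule prod_ennreal) simp
  ultimately show ?thesis by simp
qed

lemma distr_std_gauss_orthogonal_wellorder:
  fixes f :: "real^'m::{finite,wellorder} \<Rightarrow> real^'m::_"
  assumes f: "orthogonal_transformation f"
  shows "distr std_gauss borel f = std_gauss"
proof -
  let ?g = "\<lambda>x::real^'m::_. ennreal ((1 / sqrt (2 * pi)) ^ CARD('m) * exp (- (norm x)\<^sup>2 / 2))"
  note [measurable] = borel_measurable_orthogonal_transformation[OF f]
  have "distr std_gauss borel f = distr (density lborel (\<lambda>x. ?g (f x))) borel f"
    by (simp add: std_gauss_eq_density prod_std_normal_density orthogonal_transformation_norm[OF f])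
  also have "\<dots> = density (distr lborel borel f) ?g"
    by (rule density_distr[symmetric]) auto
  also have "\<dots> = std_gauss"
    by (simp add: std_gauss_eq_density prod_std_normal_density distr_lborel_orthogonal[OF f])
  finally show ?thesis .
qed

text \<open>The relabelling \<open>R\<close> with inverse \<open>T\<close> preserves inner products,
  so conjugating \<open>f\<close> by it gives an orthogonal map over the well-ordered index type,
  where invariance is known.\<close>

lemma distr_std_gauss_orthogonal:
  fixes f :: "real^'m \<Rightarrow> real^'m"
  assumes f: "orthogonal_transformation f"
  shows "distr std_gauss borel f = std_gauss"
proof -
  obtain h :: "'m \<Rightarrow> 'm index_copy" where h: "bij h"
    using ex_bij_index_copy by blast
  define R where "R = (\<lambda>z :: real^'m. (\<chi> i. z $ inv h i) :: real^'m index_copy)"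
  define T where "T = (\<lambda>z :: real^'m index_copy. (\<chi> i. z $ h i) :: real^'m)"
  have RT: "R (T z) = z" "T (R y) = y" for z y
    using h by (simp_all add: R_def T_def vec_eq_iff bij_is_surj surj_f_inv_f bij_is_inj inv_f_f)
  have inner_R: "R y \<bullet> R z = y \<bullet> z" for y z
    unfolding inner_vec_def R_def
    using sum.reindex_bij_betw[OF bij_imp_bij_inv[OF h], of "\<lambda>i. y $ i \<bullet> z $ i"] by simp
  have inner_T: "T y \<bullet> T z = y \<bullet> z" for y z
    using inner_R[of "T y" "T z"] by (simp add: RT)
  have lin: "linear R" "linear T"
    by (auto simp: R_def T_def vec_eq_iff intro!: linearI)
  have ot: "orthogonal_transformation (R \<circ> f \<circ> T)"
    using f lin unfolding orthogonal_transformation_def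
    by (auto simp: inner_R inner_T intro!: linear_compose)
  note [measurable] = borel_measurable_orthogonal_transformation[OF f]
  have [measurable]: "R \<in> borel_measurable borel" "T \<in> borel_measurable borel"
    unfolding R_def T_def by measurable
  have g: "std_gauss = distr std_gauss borel T"
    unfolding T_def by (rule std_gauss_reindex[OF bij_is_inj[OF h], symmetric])
  have "distr std_gauss borel f = distr std_gauss borel (f \<circ> T)"
    by (subst g, subst distr_distr) auto
  also have "\<dots> = distr (distr std_gauss borel (R \<circ> f \<circ> T)) borel T"
    by (subst distr_distr) (auto simp: o_def RT)
  also have "\<dots> = std_gauss"
    by (simp add: distr_std_gauss_orthogonal_wellorder[OF ot] g[symmetric])
  finally show ?thesis .
qed

subsection \<open>Gaussian vectors under linear maps with independent noise\<close>

lemma measurable_vec_case_option [measurable]: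
  "(\<lambda>(z :: real^'n, g). \<chi> i. case i of None \<Rightarrow> g | Some j \<Rightarrow> z $ j) \<in> borel \<Otimes>\<^sub>M borel \<rightarrow>\<^sub>M borel"
  unfolding borel_measurable_vec_iff case_prod_beta
proof
  fix i :: "'n option"
  show "(\<lambda>x :: (real^'n) \<times> real. (\<chi> i. case i of None \<Rightarrow> snd x | Some j \<Rightarrow> fst x $ j) $ i)
      \<in> borel_measurable (borel \<Otimes>\<^sub>M borel)"
    by (cases i) (simp, simp, measurable)
qed

text \<open>The index type \<open>'n option\<close> provides the extra dimension: the slot
  \<open>None\<close> receives the scalar noise of one measurement. Equality of the product measures
  is checked on rectangles.\<close>

lemma distr_std_gauss_option:
  "distr (std_gauss \<Otimes>\<^sub>M std_normal_distribution) borel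
     (\<lambda>(z :: real^'n, g). \<chi> i. case i of None \<Rightarrow> g | Some j \<Rightarrow> z $ j) = std_gauss"
proof -
  let ?N = "std_normal_distribution" and ?P = "\<Pi>\<^sub>M i\<in>(UNIV :: 'n set). std_normal_distribution"
  let ?Q = "\<Pi>\<^sub>M i\<in>(UNIV :: 'n option set). std_normal_distribution"
  let ?J = "\<lambda>x i. case i of None \<Rightarrow> snd x | Some j \<Rightarrow> fst x j"
  interpret N: prob_space ?N by (rule prob_space_std_normal_distribution)
  interpret P: product_sigma_finite "\<lambda>_::'n. ?N"
    unfolding product_sigma_finite_def by (intro allI N.sigma_finite_measure_axioms)
  interpret Q: product_sigma_finite "\<lambda>_::'n option. ?N"
    unfolding product_sigma_finite_def by (intro allI N.sigma_finite_measure_axioms)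
  have J [measurable]: "?J \<in> ?P \<Otimes>\<^sub>M ?N \<rightarrow>\<^sub>M ?Q"
  proof (rule measurable_PiM_single')
    fix i :: "'n option"
    show "(\<lambda>x. ?J x i) \<in> ?P \<Otimes>\<^sub>M ?N \<rightarrow>\<^sub>M ?N"
      by (cases i) simp_all
  qed auto
  have 1: "distr (?P \<Otimes>\<^sub>M ?N) ?Q ?J = ?Q"
  proof (rule Q.PiM_eqI)
    fix A :: "'n option \<Rightarrow> real set"
    assume "\<And>i. i \<in> UNIV \<Longrightarrow> A i \<in> sets ?N"
    then have A [measurable]: "\<And>i. A i \<in> sets borel" by simp
    have "?J -` Pi\<^sub>E UNIV A \<inter> space (?P \<Otimes>\<^sub>M ?N) = Pi\<^sub>E UNIV (\<lambda>j. A (Some j)) \<times> A None"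
      by (auto simp: space_pair_measure space_PiM PiE_def Pi_def extensional_def split: option.splits)
    then have "emeasure (distr (?P \<Otimes>\<^sub>M ?N) ?Q ?J) (Pi\<^sub>E UNIV A)
        = emeasure (?P \<Otimes>\<^sub>M ?N) (Pi\<^sub>E UNIV (\<lambda>j. A (Some j)) \<times> A None)"
      by (subst emeasure_distr) auto
    also have "\<dots> = emeasure ?P (Pi\<^sub>E UNIV (\<lambda>j. A (Some j))) * emeasure ?N (A None)"
      by (rule N.emeasure_pair_measure_Times) auto
    also have "\<dots> = (\<Prod>i\<in>UNIV. emeasure ?N (A i))"
      by (simp add: P.emeasure_PiM UNIV_option_conv prod.reindex mult.commute)
    finally show "emeasure (distr (?P \<Otimes>\<^sub>M ?N) ?Q ?J) (Pi\<^sub>E UNIV A) = (\<Prod>i\<in>UNIV. emeasure ?N (A i))" .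
  qed simp_all
  have "std_gauss \<Otimes>\<^sub>M ?N = distr ?P borel (\<lambda>z. \<chi> i. z i :: real^'n) \<Otimes>\<^sub>M distr ?N ?N (\<lambda>g. g)"
    by (simp add: std_gauss_def)
  also have "\<dots> = distr (?P \<Otimes>\<^sub>M ?N) (borel \<Otimes>\<^sub>M ?N) (\<lambda>(z, g). (\<chi> i. z i, g))"
    by (rule pair_measure_distr) (auto simp: N.sigma_finite_measure_axioms)
  finally have 2: "std_gauss \<Otimes>\<^sub>M ?N = distr (?P \<Otimes>\<^sub>M ?N) (borel \<Otimes>\<^sub>M ?N) (\<lambda>(z, g). (\<chi> i. z i :: real^'n, g))" .
  have [simp]: "($) (vec_lambda z) = z" for z :: "'n \<Rightarrow> real"
    by (simp add: fun_eq_iff)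
  have "distr (std_gauss \<Otimes>\<^sub>M ?N) borel
     (\<lambda>(z :: real^'n, g). \<chi> i. case i of None \<Rightarrow> g | Some j \<Rightarrow> z $ j)
     = distr (distr (?P \<Otimes>\<^sub>M ?N) ?Q ?J) borel (\<lambda>z. \<chi> i. z i)"
    unfolding 2 by (subst (1 2) distr_distr) (auto simp: o_def case_prod_beta intro!: distr_cong split: option.splits)
  then show ?thesis
    unfolding 1 std_gauss_def .
qed

lemma distr_std_gauss_component:
  "distr std_gauss borel (\<lambda>z :: real^'n. z $ i) = std_normal_distribution"
proof -
  have "distr std_gauss borel (\<lambda>z :: real^'n. z $ i)
      = distr (\<Pi>\<^sub>M i\<in>(UNIV :: 'n set). std_normal_distribution) std_normal_distribution (\<lambda>z. z i)"
    unfolding std_gauss_def by (subst distr_distr) (auto simp: o_def intro!: distr_cong)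
  then show ?thesis
    by (simp add: distr_PiM_component[where M = "\<lambda>_. std_normal_distribution"] prob_space_std_normal_distribution)
qed

text \<open>A rotation carries \<open>norm v\<close> times an axis vector to \<open>v\<close>, which
  reduces the inner product to a multiple of a single coordinate.\<close>

lemma distr_std_gauss_inner:
  fixes v :: "real^'n"
  shows "distr std_gauss borel (\<lambda>z. v \<bullet> z) = distr std_normal_distribution borel (\<lambda>g. norm v * g)"
proof -
  fix i :: 'n
  obtain f :: "real^'n \<Rightarrow> real^'n" where f: "orthogonal_transformation f" "f (norm v *\<^sub>R axis i 1) = v"
    by (rule orthogonal_transformation_exists[of "norm v *\<^sub>R axis i 1" v]) simp_all
  note [measurable] = borel_measurable_orthogonal_transformation[OF f(1)]
  have "v \<bullet> f z = norm v * z $ i" for z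
  proof -
    have "f (norm v *\<^sub>R axis i 1) \<bullet> f z = (norm v *\<^sub>R axis i 1) \<bullet> z"
      using f(1) unfolding orthogonal_transformation_def by blast
    then show ?thesis by (simp add: f(2) inner_axis inner_commute)
  qed
  moreover have "distr std_gauss borel (\<lambda>z. v \<bullet> z) = distr (distr std_gauss borel f) borel (\<lambda>z. v \<bullet> z)"
    by (simp add: distr_std_gauss_orthogonal[OF f(1)])
  ultimately have "distr std_gauss borel (\<lambda>z. v \<bullet> z) = distr (distr std_gauss borel (\<lambda>z. z $ i)) borel (\<lambda>g. norm v * g)"
    by (simp add: distr_distr o_def)
  then show ?thesis
    by (simp add: distr_std_gauss_component)
qed

lemma matrix_mult_nth: "(A ** B) $ i $ j = (\<Sum>k\<in>UNIV. A $ i $ k * B $ k $ j)"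
  by (simp add: matrix_matrix_mult_def)

text \<open>A linear map from \<open>n + 1\<close> to \<open>n\<close> dimensions kills some unit vector; rotating that vector
  onto the extra coordinate axis makes the extra coordinate drop out.\<close>

lemma std_gauss_drop_coordinate:
  fixes L :: "real^('n option)^'n"
  obtains B :: "real^'n^'n" where "B ** transpose B = L ** transpose L"
    and "distr std_gauss borel (\<lambda>z. L *v z) = distr std_gauss borel (\<lambda>z. B *v z)"
proof -
  \<comment> \<open>The rank is at most the number of rows, one less than the number of columns, so
    the kernel is nontrivial.\<close>
  have "rank L \<noteq> CARD('n option)"
    using rank_bound[of L] by simp
  then obtain u where u: "u \<noteq> 0" "L *v u = 0"
    using matrix_nonfull_linear_equations_eq[of L] by blast
  have "norm (axis None 1 :: real^'n option) = norm (u /\<^sub>R norm u)"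
    using u(1) by simp
  then obtain f :: "real^'n option \<Rightarrow> real^'n option" where f: "orthogonal_transformation f" "f (axis None 1) = u /\<^sub>R norm u"
    by (rule orthogonal_transformation_exists)
  define Q where "Q = matrix f"
  have fQ: "f z = Q *v z" for z
    using orthogonal_transformation_linear[OF f(1)]
    by (simp add: Q_def matrix_works linear_matrix_vector_mul_eq)
  have Q: "Q ** transpose Q = mat 1"
    using f(1) by (simp add: orthogonal_transformation_matrix orthogonal_matrix_def Q_def)
  define K where "K = L ** Q"
  \<comment> \<open>\<open>Q\<close> sends the extra axis to the normalised kernel vector of
    \<open>L\<close>, so the column \<open>None\<close> of \<open>K = L ** Q\<close> vanishes and
    \<open>B\<close> keeps the remaining columns.\<close>
  have "K *v axis None 1 = 0"
    using u(2) by (simp add: K_def matrix_vector_mul_assoc[symmetric] fQ[symmetric] f(2) matrix_vector_mult_scaleR)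
  then have K0: "K $ i $ None = 0" for i
    by (simp add: matrix_vector_mult_basis column_def vec_eq_iff)
  define B where "B = (\<chi> i j. K $ i $ Some j)"
  have BK: "K *v z = B *v (\<chi> j. z $ Some j)" for z
    by (simp add: B_def matrix_vector_mult_def UNIV_option_conv sum.reindex K0)
  have "B ** transpose B = K ** transpose K"
    by (simp add: B_def vec_eq_iff matrix_mult_nth transpose_def UNIV_option_conv sum.reindex K0)
  also have "\<dots> = L ** (Q ** transpose Q) ** transpose L"
    by (simp add: K_def matrix_transpose_mul matrix_mul_assoc)
  also have "\<dots> = L ** transpose L"
    by (simp add: Q)
  finally have BB: "B ** transpose B = L ** transpose L" .
  have "distr std_gauss borel (\<lambda>z. L *v z) = distr (distr std_gauss borel f) borel (\<lambda>z. L *v z)"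
    by (simp add: distr_std_gauss_orthogonal[OF f(1)])
  also have "\<dots> = distr std_gauss borel (\<lambda>z. K *v z)"
    unfolding fQ by (subst distr_distr) (auto simp: o_def K_def matrix_vector_mul_assoc)
  also have "\<dots> = distr (distr std_gauss borel (\<lambda>z. \<chi> j. z $ Some j)) borel (\<lambda>z. B *v z)"
    unfolding BK by (subst distr_distr) (auto simp: o_def)
  also have "\<dots> = distr std_gauss borel (\<lambda>z. B *v z)"
    by (subst std_gauss_reindex) auto
  finally show thesis using BB that by blast
qed

text \<open>Independence makes the joint law of \<open>e\<close> and \<open>a \<bullet> w\<close> a
  product, hence that of \<open>B *v z\<close> and \<open>s * g\<close> with independent standard
  \<open>z\<close> and \<open>g\<close>. The combination is then a linear image of one standard
  Gaussian in dimension \<open>n + 1\<close>, to which the coordinate drop applies.\<close>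

lemma (in prob_space) normal_linear_plus_noise:
  fixes e w :: "'a \<Rightarrow> real^'n" and P :: "real^'n^'n"
  assumes indep: "indep_var borel e borel w"
    and e: "distr M borel e = affine_std_normal 0 B"
    and w: "normal_vector M w 0 (mat (\<sigma>\<^sup>2))" and a: "norm a = 1"
  obtains B' where "distr M borel (\<lambda>\<omega>. P *v e \<omega> + (a \<bullet> w \<omega>) *\<^sub>R k) = affine_std_normal 0 B'"
    and "B' ** transpose B' = P ** (B ** transpose B) ** transpose P + \<sigma>\<^sup>2 *\<^sub>R (\<chi> i j. k $ i * k $ j)"
proof -
  let ?N = "std_normal_distribution"
  have ew [measurable]: "e \<in> borel_measurable M" "w \<in> borel_measurable M"
    using indep indep_var_rv1 indep_var_rv2 by blast+
  obtain A where A: "mat (\<sigma>\<^sup>2) = A ** transpose A" "distr M borel w = affine_std_normal 0 A"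
    using w by (auto simp: normal_vector_def)
  \<comment> \<open>The factor \<open>A\<close> of the noise covariance is not unique, but
    \<open>s^2\<close> is the quadratic form of \<open>A ** transpose A\<close> at \<open>a\<close>,
    hence \<sigma>^2 for every choice.\<close>
  define s where "s = norm (transpose A *v a)"
  have "s\<^sup>2 = (transpose A *v a) \<bullet> (transpose A *v a)"
    by (simp add: s_def dot_square_norm)
  also have "\<dots> = a \<bullet> (mat (\<sigma>\<^sup>2) *v a)"
    by (simp add: A(1) matrix_vector_mul_assoc[symmetric] dot_lmul_matrix[symmetric])
  also have "mat (\<sigma>\<^sup>2) *v a = \<sigma>\<^sup>2 *\<^sub>R a"
    by (simp add: vec_eq_iff matrix_vector_mult_def mat_def if_distrib[of "\<lambda>x. x * _"] cong: if_cong)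
  also have "a \<bullet> (\<sigma>\<^sup>2 *\<^sub>R a) = \<sigma>\<^sup>2"
    using a by (simp add: dot_square_norm)
  finally have s: "s\<^sup>2 = \<sigma>\<^sup>2" .
  have "distr M borel (\<lambda>\<omega>. a \<bullet> w \<omega>) = distr (distr M borel w) borel (\<lambda>v. a \<bullet> v)"
    by (subst distr_distr) (auto simp: o_def)
  also have "\<dots> = distr std_gauss borel (\<lambda>z. a \<bullet> (A *v z))"
    unfolding A(2) affine_std_normal_eq_distr by (subst distr_distr) (auto simp: o_def)
  also have "\<dots> = distr ?N borel (\<lambda>g. s * g)"
    unfolding s_def distr_std_gauss_inner[symmetric] by (simp add: dot_lmul_matrix[symmetric])
  finally have aw: "distr M borel (\<lambda>\<omega>. a \<bullet> w \<omega>) = distr ?N borel (\<lambda>g. s * g)" .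
  have "distr M (borel \<Otimes>\<^sub>M borel) (\<lambda>\<omega>. (e \<omega>, a \<bullet> w \<omega>))
      = distr (distr M (borel \<Otimes>\<^sub>M borel) (\<lambda>\<omega>. (e \<omega>, w \<omega>))) (borel \<Otimes>\<^sub>M borel) (\<lambda>(u, v). (u, a \<bullet> v))"
    by (subst distr_distr) (auto simp: o_def)
  also have "\<dots> = distr (distr M borel e \<Otimes>\<^sub>M distr M borel w) (borel \<Otimes>\<^sub>M borel) (\<lambda>(u, v). (u, a \<bullet> v))"
    using indep by (simp add: indep_var_distribution_eq)
  also have "\<dots> = distr (distr M borel e) borel (\<lambda>u. u) \<Otimes>\<^sub>M distr (distr M borel w) borel (\<lambda>v. a \<bullet> v)"
    by (intro pair_measure_distr[symmetric] prob_space_imp_sigma_finite prob_space.prob_space_distr prob_space_distr) auto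
  also have "\<dots> = distr M borel e \<Otimes>\<^sub>M distr M borel (\<lambda>\<omega>. a \<bullet> w \<omega>)"
    by (subst (1 2) distr_distr) (auto simp: o_def)
  also have "\<dots> = distr std_gauss borel (\<lambda>z. B *v z) \<Otimes>\<^sub>M distr ?N borel (\<lambda>g. s * g)"
    by (simp add: e aw affine_std_normal_eq_distr)
  also have "\<dots> = distr (std_gauss \<Otimes>\<^sub>M ?N) (borel \<Otimes>\<^sub>M borel) (\<lambda>(z, g). (B *v z, s * g))"
    by (intro pair_measure_distr prob_space_imp_sigma_finite prob_space.prob_space_distr
        prob_space_std_normal_distribution) auto
  finally have joint: "distr M (borel \<Otimes>\<^sub>M borel) (\<lambda>\<omega>. (e \<omega>, a \<bullet> w \<omega>))
      = distr (std_gauss \<Otimes>\<^sub>M ?N) (borel \<Otimes>\<^sub>M borel) (\<lambda>(z, g). (B *v z, s * g))" .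
  \<comment> \<open>The columns of \<open>P ** B\<close> act on the old error and the extra column
    \<open>s k\<close> on the noise; in \<open>L ** transpose L\<close> that column contributes the
    term with \<open>s^2\<close>.\<close>
  define L :: "real^('n option)^'n" where
    "L = (\<chi> i j. case j of None \<Rightarrow> s * k $ i | Some j \<Rightarrow> (P ** B) $ i $ j)"
  have L: "L *v (\<chi> i. case i of None \<Rightarrow> g | Some j \<Rightarrow> z $ j) = P *v (B *v z) + (s * g) *\<^sub>R k" for z g
    unfolding matrix_vector_mul_assoc
    by (simp add: L_def matrix_vector_mult_def UNIV_option_conv sum.reindex
        vec_eq_iff algebra_simps)
  have "distr M borel (\<lambda>\<omega>. P *v e \<omega> + (a \<bullet> w \<omega>) *\<^sub>R k)
      = distr (distr M (borel \<Otimes>\<^sub>M borel) (\<lambda>\<omega>. (e \<omega>, a \<bullet> w \<omega>))) borel (\<lambda>(v, t). P *v v + t *\<^sub>R k)"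
    by (subst distr_distr) (auto simp: o_def)
  also have "\<dots> = distr (std_gauss \<Otimes>\<^sub>M ?N) borel (\<lambda>(z, g). P *v (B *v z) + (s * g) *\<^sub>R k)"
    unfolding joint case_prod_beta by (subst distr_distr) (auto simp: o_def)
  also have "\<dots> = distr (distr (std_gauss \<Otimes>\<^sub>M ?N) borel
      (\<lambda>(z, g). \<chi> i. case i of None \<Rightarrow> g | Some j \<Rightarrow> z $ j)) borel (\<lambda>z. L *v z)"
    by (subst distr_distr) (auto simp: o_def case_prod_beta' L)
  also have "\<dots> = distr std_gauss borel (\<lambda>z. L *v z)"
    by (simp add: distr_std_gauss_option)
  finally have law: "distr M borel (\<lambda>\<omega>. P *v e \<omega> + (a \<bullet> w \<omega>) *\<^sub>R k) = distr std_gauss borel (\<lambda>z. L *v z)" .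
  obtain B' :: "real^'n^'n" where B': "B' ** transpose B' = L ** transpose L"
    "distr std_gauss borel (\<lambda>z. L *v z) = distr std_gauss borel (\<lambda>z. B' *v z)"
    by (rule std_gauss_drop_coordinate)
  define R where "R = P ** B"
  have "L ** transpose L = R ** transpose R + \<sigma>\<^sup>2 *\<^sub>R (\<chi> i j. k $ i * k $ j)"
    unfolding L_def R_def[symmetric] s[symmetric]
    by (simp add: vec_eq_iff matrix_mult_nth transpose_def UNIV_option_conv sum.reindex
        power2_eq_square mult_ac)
  then have "B' ** transpose B' = P ** (B ** transpose B) ** transpose P + \<sigma>\<^sup>2 *\<^sub>R (\<chi> i j. k $ i * k $ j)"
    by (simp add: B'(1) R_def matrix_transpose_mul matrix_mul_assoc)
  with law B'(2) show thesis
    by (intro that[of B']) (simp_all add: affine_std_normal_eq_distr)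
qed

subsection \<open>The chi-squared quantile\<close>

lemma measurable_vec_lambda_PiM [measurable]:
  "vec_lambda \<in> borel_measurable (\<Pi>\<^sub>M i\<in>(UNIV :: 'n::finite set). std_normal_distribution)"
  by (simp add: borel_measurable_vec_iff)

text \<open>An enumeration of \<open>'n\<close> transports the product over \<open>{..<n}\<close> to
  the vectors in which the error lives.\<close>

lemma chi_squared_eq_distr_norm:
  "chi_squared CARD('n) = distr std_gauss borel (\<lambda>z :: real^'n. (norm z)\<^sup>2)"
proof -
  let ?N = "std_normal_distribution" and ?n = "CARD('n)"
  obtain h :: "'n \<Rightarrow> nat" where h: "bij_betw h UNIV {..<?n}"
    using ex_bij_betw_finite_nat[OF finite_class.finite_UNIV] by (auto simp: atLeast0LessThan)
  have "h i \<in> {..<?n}" for i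
    using h by (auto simp: bij_betw_def)
  then have [measurable]: "(\<lambda>\<omega>. \<omega> (h i)) \<in> borel_measurable (\<Pi>\<^sub>M i\<in>{..<?n}. ?N)" for i
    using measurable_component_singleton[of "h i" "{..<?n}" "\<lambda>_. ?N"] by simp
  have "std_gauss = distr (distr (\<Pi>\<^sub>M i\<in>{..<?n}. ?N) (\<Pi>\<^sub>M i\<in>UNIV. ?N) (\<lambda>\<omega>. \<lambda>n\<in>UNIV. \<omega> (h n)))
      borel (\<lambda>z. \<chi> i. z i :: real^'n)"
    unfolding std_gauss_def
    by (subst distr_PiM_reindex) (use h in \<open>auto simp: bij_betw_def prob_space_std_normal_distribution\<close>)
  also have "\<dots> = distr (\<Pi>\<^sub>M i\<in>{..<?n}. ?N) borel (\<lambda>\<omega>. \<chi> i. \<omega> (h i))"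
    by (subst distr_distr) (auto simp: o_def restrict_UNIV intro!: measurable_PiM_single')
  finally have G: "std_gauss = distr (\<Pi>\<^sub>M i\<in>{..<?n}. ?N) borel (\<lambda>\<omega>. \<chi> i. \<omega> (h i) :: real^'n)" .
  have "distr std_gauss borel (\<lambda>z :: real^'n. (norm z)\<^sup>2)
      = distr (\<Pi>\<^sub>M i\<in>{..<?n}. ?N) borel (\<lambda>\<omega>. (norm (\<chi> i. \<omega> (h i) :: real^'n))\<^sup>2)"
    unfolding G by (subst distr_distr) (auto simp: o_def)
  moreover have "(norm (\<chi> i. \<omega> (h i) :: real^'n))\<^sup>2 = (\<Sum>i<?n. (\<omega> i)\<^sup>2)" for \<omega> :: "nat \<Rightarrow> real"
    using sum.reindex_bij_betw[OF h, of "\<lambda>i. (\<omega> i)\<^sup>2"] by (simp add: norm_vec_def L2_set_def sum_nonneg)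
  ultimately show ?thesis
    by (simp add: chi_squared_def)
qed

text \<open>Spheres are Lebesgue null. This identifies the cdf with the probability of the open
  ball, as the strict error bound demands.\<close>

lemma measure_std_gauss_norm_eq:
  "measure std_gauss {z :: real^'n. (norm z)\<^sup>2 = c} = 0"
proof -
  have "closed {z :: real^'n. (norm z)\<^sup>2 = c}"
    by (intro closed_Collect_eq continuous_intros)
  then have [measurable]: "{z :: real^'n. (norm z)\<^sup>2 = c} \<in> sets borel"
    by (rule borel_closed)
  have "{z :: real^'n. (norm z)\<^sup>2 = c} \<subseteq> sphere 0 (sqrt c)"
    by auto
  then have "negligible {z :: real^'n. (norm z)\<^sup>2 = c}"
    using negligible_sphere negligible_subset by blast
  then have "{z :: real^'n. (norm z)\<^sup>2 = c} \<in> null_sets lborel"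
    by (simp add: negligible_iff_null_sets null_sets_completion_iff)
  then have "{z :: real^'n. (norm z)\<^sup>2 = c} \<in> null_sets std_gauss"
    unfolding std_gauss_eq_density
    by (subst null_sets_density_iff) (auto intro: AE_I')
  then show ?thesis
    by (simp add: measure_def null_setsD1)
qed

lemma real_distribution_chi_squared: "real_distribution (chi_squared n)"
  unfolding chi_squared_def real_distribution_def real_distribution_axioms_def
  by (auto intro!: prob_space.prob_space_distr prob_space_PiM prob_space_std_normal_distribution)

text \<open>The infimum is attained: if the cdf were below \<open>p\<close> at the quantile,
  right-continuity would keep it below \<open>p\<close> on an interval to the right, and the set
  could not come close to its infimum.\<close>

lemma (in real_distribution) le_cdf_quantile:
  assumes "p < 1" and bdd: "bdd_below {q. p \<le> cdf M q}"
  shows "p \<le> cdf M (quantile M p)"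
proof (rule ccontr)
  assume less: "\<not> p \<le> cdf M (quantile M p)"
  \<comment> \<open>The cdf tends to 1 > \<open>p\<close>, so the set is nonempty and
    \<open>Inf\<close> is a genuine infimum.\<close>
  have "eventually (\<lambda>q. p < cdf M q) at_top"
    using cdf_lim_at_top_prob \<open>p < 1\<close> by (rule order_tendstoD)
  then obtain q0 where "p < cdf M q0"
    by (auto simp: eventually_at_top_linorder)
  then have ne: "{q. p \<le> cdf M q} \<noteq> {}"
    using less_imp_le by blast
  have "(cdf M \<longlongrightarrow> cdf M (quantile M p)) (at_right (quantile M p))"
    using cdf_is_right_cont by (simp add: continuous_within)
  then have "eventually (\<lambda>q. cdf M q < p) (at_right (quantile M p))"
    using less by (intro order_tendstoD(2)) auto
  then obtain b where b: "b > quantile M p" "\<And>q. quantile M p < q \<Longrightarrow> q < b \<Longrightarrow> cdf M q < p"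
    by (auto simp: eventually_at_right_field)
  then obtain q where q: "p \<le> cdf M q" "q < b"
    using cInf_less_iff[OF ne bdd, of b] by (auto simp: quantile_def)
  moreover have "quantile M p \<le> q"
    unfolding quantile_def using q bdd by (intro cInf_lower) auto
  ultimately show False
    using b(2)[of q] less by (cases "q = quantile M p") auto
qed

text \<open>The cdf vanishes on nonpositive arguments. This bounds the set in the quantile below by
  0, and it forces the quantile to be positive because the cdf there is at least
  \<open>p > 0\<close>.\<close>

lemma
  assumes "0 < p" "p < 1"
  shows quantile_chi_squared_pos: "0 < quantile (chi_squared CARD('n)) p"
    and measure_std_gauss_quantile_chi_squared:
      "p \<le> measure std_gauss {z :: real^'n. (norm z)\<^sup>2 < quantile (chi_squared CARD('n)) p}"
proof -
  let ?D = "chi_squared CARD('n)" and ?G = "std_gauss :: (real^'n) measure"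
  define c where "c = quantile ?D p"
  interpret D: real_distribution ?D
    by (rule real_distribution_chi_squared)
  interpret G: prob_space ?G
    by (rule prob_space_std_gauss)
  have sets [measurable]: "{z :: real^'n. (norm z)\<^sup>2 < q} \<in> sets borel"
    "{z :: real^'n. (norm z)\<^sup>2 = q} \<in> sets borel" for q
    by (auto intro!: borel_closed borel_open closed_Collect_eq open_Collect_less continuous_intros)
  have cdf: "cdf ?D q = measure ?G {z. (norm z)\<^sup>2 < q}" for q
  proof -
    have "cdf ?D q = measure ?G {z. (norm z)\<^sup>2 \<le> q}"
      unfolding chi_squared_eq_distr_norm cdf_def
      by (subst measure_distr) (auto simp: vimage_def)
    also have "{z :: real^'n. (norm z)\<^sup>2 \<le> q} = {z. (norm z)\<^sup>2 < q} \<union> {z. (norm z)\<^sup>2 = q}"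
      by auto
    also have "measure ?G \<dots> = measure ?G {z. (norm z)\<^sup>2 < q} + measure ?G {z. (norm z)\<^sup>2 = q}"
      by (rule G.finite_measure_Union) auto
    finally show ?thesis
      by (simp add: measure_std_gauss_norm_eq)
  qed
  have nonpos: "cdf ?D q = 0" if "q \<le> 0" for q
  proof -
    have "{z :: real^'n. (norm z)\<^sup>2 < q} = {}"
      using that by (auto simp: not_less intro: order_trans[OF _ zero_le_power2])
    then show ?thesis by (simp add: cdf)
  qed
  have "bdd_below {q. p \<le> cdf ?D q}"
  proof (rule bdd_belowI)
    fix q assume "q \<in> {q. p \<le> cdf ?D q}"
    then show "0 \<le> q"
      using nonpos[of q] \<open>0 < p\<close> by (cases "q \<le> 0") auto
  qed
  then have "p \<le> cdf ?D c"
    unfolding c_def using \<open>p < 1\<close> by (rule D.le_cdf_quantile[rotated])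
  then show "0 < quantile ?D p" "p \<le> measure ?G {z. (norm z)\<^sup>2 < quantile ?D p}"
    using nonpos[of c] \<open>0 < p\<close> unfolding c_def[symmetric] by (force simp: not_le[symmetric], simp add: cdf)
qed

text \<open>The hypothesis concerns \<open>B ** transpose B\<close>, the conclusion
  \<open>B\<close>. For \<open>u = B *v z\<close>, Cauchy-Schwarz applied to
  \<open>transpose B *v u\<close> and \<open>z\<close> bounds \<open>|u|^4\<close> by
  \<open>r |u|^2 |z|^2\<close>, and \<open>|u|^2\<close> cancels.\<close>

lemma norm_matrix_vector_le:
  fixes B :: "real^'n^'n"
  assumes "\<And>v. v \<bullet> ((B ** transpose B) *v v) \<le> r * (v \<bullet> v)"
  shows "(norm (B *v z))\<^sup>2 \<le> r * (norm z)\<^sup>2"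
proof (cases "B *v z = 0")
  \<comment> \<open>Nothing can be cancelled here, and the sign of \<open>r\<close> is not given;
    that the right-hand side is nonnegative follows from the hypothesis at \<open>z\<close>.\<close>
  case True
  have "0 \<le> (transpose B *v z) \<bullet> (transpose B *v z)" by simp
  also have "\<dots> = z \<bullet> ((B ** transpose B) *v z)"
    by (simp add: matrix_vector_mul_assoc[symmetric] dot_lmul_matrix[symmetric])
  also have "\<dots> \<le> r * (norm z)\<^sup>2"
    using assms[of z] by (simp add: dot_square_norm)
  finally show ?thesis using True by simp
next
  case False
  define u where "u = B *v z"
  have "((norm u)\<^sup>2)\<^sup>2 = ((transpose B *v u) \<bullet> z)\<^sup>2"
    by (simp add: u_def dot_square_norm[symmetric] dot_lmul_matrix)
  also have "\<dots> \<le> ((transpose B *v u) \<bullet> (transpose B *v u)) * (z \<bullet> z)"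
    by (rule Cauchy_Schwarz_ineq)
  also have "(transpose B *v u) \<bullet> (transpose B *v u) = u \<bullet> ((B ** transpose B) *v u)"
    by (simp add: matrix_vector_mul_assoc[symmetric] dot_lmul_matrix[symmetric])
  also have "\<dots> * (z \<bullet> z) \<le> r * (norm u)\<^sup>2 * (norm z)\<^sup>2"
    unfolding dot_square_norm[symmetric] by (intro mult_right_mono assms) simp
  finally have "(norm u)\<^sup>2 * (norm u)\<^sup>2 \<le> (r * (norm z)\<^sup>2) * (norm u)\<^sup>2"
    by (simp add: power2_eq_square mult_ac)
  moreover have "0 < (norm u)\<^sup>2"
    using False by (simp add: u_def)
  ultimately show ?thesis
    unfolding u_def by (rule mult_right_le_imp_le)
qed

lemma measure_affine_std_normal_ball:
  fixes B :: "real^'n^'n"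
  assumes p: "0 < p" "p < 1" and c: "c = quantile (chi_squared CARD('n)) p" and "\<epsilon> > 0"
    and B: "\<And>v. v \<bullet> ((B ** transpose B) *v v) \<le> \<epsilon>\<^sup>2 / c * (v \<bullet> v)"
  shows "p \<le> measure (affine_std_normal 0 B) {v. norm v < \<epsilon>}"
proof -
  have c0: "0 < c"
    unfolding c by (rule quantile_chi_squared_pos[OF p])
  interpret G: prob_space "std_gauss :: (real^'n) measure"
    by (rule prob_space_std_gauss)
  have "p \<le> measure std_gauss {z :: real^'n. (norm z)\<^sup>2 < c}"
    unfolding c by (rule measure_std_gauss_quantile_chi_squared[OF p])
  also have "\<dots> \<le> measure std_gauss {z. norm (B *v z) < \<epsilon>}"
  proof (rule G.finite_measure_mono)
    show "{z. (norm z)\<^sup>2 < c} \<subseteq> {z. norm (B *v z) < \<epsilon>}"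
    proof safe
      fix z :: "real^'n"
      assume z: "(norm z)\<^sup>2 < c"
      have "(norm (B *v z))\<^sup>2 \<le> \<epsilon>\<^sup>2 / c * (norm z)\<^sup>2"
        by (rule norm_matrix_vector_le[OF B])
      also have "\<dots> < \<epsilon>\<^sup>2 / c * c"
        using z c0 \<open>\<epsilon> > 0\<close> by (intro mult_strict_left_mono) auto
      finally have "(norm (B *v z))\<^sup>2 < \<epsilon>\<^sup>2"
        using c0 by simp
      then show "norm (B *v z) < \<epsilon>"
        by (rule power2_less_imp_less) (use \<open>\<epsilon> > 0\<close> in simp)
    qed
    have "{z. norm (B *v z) < \<epsilon>} = (\<lambda>z. B *v z) -` ball 0 \<epsilon> \<inter> space borel"
      by auto
    also have "\<dots> \<in> sets borel"
      by (rule measurable_sets[of _ borel borel]) auto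
    finally show "{z. norm (B *v z) < \<epsilon>} \<in> sets std_gauss"
      by simp
  qed
  also have "{z. norm (B *v z) < \<epsilon>} = (\<lambda>z. 0 + B *v z) -` ball 0 \<epsilon> \<inter> space std_gauss"
    by auto
  also have "measure std_gauss \<dots> = measure (affine_std_normal 0 B) (ball 0 \<epsilon>)"
    unfolding affine_std_normal_eq_distr by (rule measure_distr[symmetric]) auto
  also have "ball 0 \<epsilon> = {v. norm v < \<epsilon>}"
    by auto
  finally show ?thesis .
qed

subsection \<open>Spectra of symmetric matrices\<close>

lemma symmetric_matrix_inner:
  fixes C :: "real^'n^'n"
  assumes "transpose C = C"
  shows "v \<bullet> (C *v u) = (C *v v) \<bullet> u"
  using dot_lmul_matrix[of v C u] transpose_matrix_vector[of C v] assms by simp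

text \<open>A first-order condition without derivatives: near 0 a linear term cannot stay below a
  quadratic one on both sides.\<close>

lemma linear_nonneg_near_zero_imp_zero:
  fixes a b :: real
  assumes "\<And>t. 2 * t * a \<le> t\<^sup>2 * b"
  shows "a = 0"
proof (rule ccontr)
  assume "a \<noteq> 0"
  \<comment> \<open>At this point the left side is \<open>2 a^2 / (|b| + 1)\<close>, while the right
    side is at most half of that.\<close>
  define s where "s = a / (\<bar>b\<bar> + 1)"
  have "2 * s * a \<le> s\<^sup>2 * (\<bar>b\<bar> + 1)"
    using assms[of s] by (smt (verit) mult_left_mono zero_le_power2)
  also have "\<dots> = s * a"
    by (simp add: s_def power2_eq_square)
  finally have "a * a / (\<bar>b\<bar> + 1) \<le> 0"
    by (simp add: s_def)
  moreover have "0 < a * a / (\<bar>b\<bar> + 1)"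
    using \<open>a \<noteq> 0\<close> by (intro divide_pos_pos) (auto simp: zero_less_mult_iff)
  ultimately show False by simp
qed

text \<open>The Rayleigh quotient attains its maximum on the unit sphere of \<open>W\<close> by
  compactness, and a maximiser is an eigenvector. The version for invariant subspaces serves both
  the construction of eigenbases, with an orthogonal complement as \<open>W\<close>, and the largest
  eigenvalue, with the whole space.\<close>

lemma symmetric_max_eigenvector:
  fixes C :: "real^'n^'n"
  assumes sym: "transpose C = C" and W: "subspace W" "W \<noteq> {0}"
    and inv: "\<And>v. v \<in> W \<Longrightarrow> C *v v \<in> W"
  obtains v where "v \<in> W" "norm v = 1" "C *v v = (v \<bullet> (C *v v)) *\<^sub>R v"
    "\<And>u. u \<in> W \<Longrightarrow> u \<bullet> (C *v u) \<le> (v \<bullet> (C *v v)) * (u \<bullet> u)"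
proof -
  let ?q = "\<lambda>v. v \<bullet> (C *v v)"
  have "compact (W \<inter> sphere 0 1)"
    using closed_subspace[OF W(1)] by (intro closed_Int_compact) auto
  moreover have "W \<inter> sphere 0 1 \<noteq> {}"
  proof -
    obtain v where "v \<in> W" "v \<noteq> 0"
      using W subspace_0 by blast
    then have "v /\<^sub>R norm v \<in> W \<inter> sphere 0 1"
      using W(1) by (simp add: subspace_mul)
    then show ?thesis by blast
  qed
  moreover have "continuous_on (W \<inter> sphere 0 1) ?q"
    by (intro continuous_intros linear_continuous_on matrix_vector_mul_bounded_linear)
  ultimately obtain v where v: "v \<in> W \<inter> sphere 0 1" "\<And>u. u \<in> W \<inter> sphere 0 1 \<Longrightarrow> ?q u \<le> ?q v"
    using continuous_attains_sup[of "W \<inter> sphere 0 1" ?q] by blast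
  define l where "l = ?q v"
  have le: "?q u \<le> l * (u \<bullet> u)" if u: "u \<in> W" for u
  proof (cases "u = 0")
    case False
    have "?q (u /\<^sub>R norm u) \<le> l"
      unfolding l_def using u W(1) False by (intro v(2)) (simp add: subspace_mul)
    moreover have "?q (u /\<^sub>R norm u) = ?q u / (u \<bullet> u)"
      by (simp add: matrix_vector_mult_scaleR dot_square_norm power2_eq_square divide_inverse mult_ac)
    ultimately show ?thesis
      using False by (simp add: pos_divide_le_eq)
  qed simp
  \<comment> \<open>The residual lies in \<open>W\<close> by invariance, so \<open>v\<close> may be
    perturbed along it; the first-order term of the maximality inequality is twice
    \<open>w \<bullet> w\<close>, which must vanish.\<close>
  define w where "w = C *v v - l *\<^sub>R v"
  have vv: "v \<bullet> v = 1"
    using v(1) by (simp add: dot_square_norm)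
  have "w \<in> W"
    unfolding w_def using v(1) inv W(1) by (intro subspace_diff subspace_mul) auto
  have "2 * t * (w \<bullet> w) \<le> t\<^sup>2 * (l * (w \<bullet> w) - ?q w)" for t
  proof -
    have e1: "?q (v + t *\<^sub>R w) \<le> l * ((v + t *\<^sub>R w) \<bullet> (v + t *\<^sub>R w))"
      using v(1) \<open>w \<in> W\<close> W(1) by (intro le subspace_add subspace_mul) auto
    have "v \<bullet> (C *v w) = w \<bullet> (C *v v)"
      using symmetric_matrix_inner[OF sym, of v w] by (simp add: inner_commute)
    then have e2: "?q (v + t *\<^sub>R w) = l + 2 * t * (w \<bullet> (C *v v)) + t\<^sup>2 * ?q w"
      by (simp add: matrix_vector_right_distrib matrix_vector_mult_scaleR inner_add_left
          inner_add_right l_def power2_eq_square algebra_simps)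
    have e3: "(v + t *\<^sub>R w) \<bullet> (v + t *\<^sub>R w) = 1 + 2 * t * (w \<bullet> v) + t\<^sup>2 * (w \<bullet> w)"
      by (simp add: inner_add_left inner_add_right vv power2_eq_square inner_commute[of v w] algebra_simps)
    have "w \<bullet> w = w \<bullet> (C *v v) - l * (w \<bullet> v)"
      by (subst (2) w_def) (simp add: inner_diff_right)
    then have e4: "w \<bullet> (C *v v) = w \<bullet> w + l * (w \<bullet> v)"
      by simp
    show ?thesis
      using e1 unfolding e2 e3 e4 by (simp add: algebra_simps)
  qed
  then have "w \<bullet> w = 0"
    by (rule linear_nonneg_near_zero_imp_zero)
  then have "C *v v = l *\<^sub>R v"
    by (simp add: w_def)
  with v(1) le show thesis
    by (intro that[of v]) (simp_all add: vv)
qed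

text \<open>The eigenvalue is read off as the Rayleigh quotient instead of being stored, so the same
  set \<open>F\<close> can be tested against different matrices.\<close>

definition orthonormal_eigenvectors :: "real^'n^'n \<Rightarrow> (real^'n) set \<Rightarrow> bool" where
  "orthonormal_eigenvectors C F \<longleftrightarrow> pairwise orthogonal F \<and>
     (\<forall>b\<in>F. norm b = 1 \<and> C *v b = (b \<bullet> (C *v b)) *\<^sub>R b)"

lemma orthonormal_eigenvectors_independent:
  "orthonormal_eigenvectors C F \<Longrightarrow> independent F"
  by (rule pairwise_orthogonal_independent) (auto simp: orthonormal_eigenvectors_def)

lemma orthonormal_eigenvectors_finite:
  "orthonormal_eigenvectors C F \<Longrightarrow> finite F"
  using orthonormal_eigenvectors_independent independent_imp_finite by blast

text \<open>Stated as an extension so that the eigenbasis can be made to contain the measured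
  direction. The induction is on the codimension of \<open>F\<close>.\<close>

lemma orthonormal_eigenvectors_extend_to_basis:
  fixes C :: "real^'n^'n"
  assumes sym: "transpose C = C" and "orthonormal_eigenvectors C F"
  obtains G where "F \<subseteq> G" "orthonormal_eigenvectors C G" "span G = UNIV"
proof -
  have "\<exists>G. F \<subseteq> G \<and> orthonormal_eigenvectors C G \<and> span G = UNIV"
    using assms(2)
  proof (induction "DIM(real^'n) - card F" arbitrary: F rule: less_induct)
    case less
    show ?case
    proof (cases "span F = UNIV")
      case False
      let ?W = "{v. \<forall>b\<in>F. b \<bullet> v = 0}"
      have F: "b \<in> F \<Longrightarrow> C *v b = (b \<bullet> (C *v b)) *\<^sub>R b" for b
        using less.prems by (simp add: orthonormal_eigenvectors_def)
      have sub: "subspace ?W"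
        by (auto simp: subspace_def inner_add_right)
      \<comment> \<open>Symmetry moves \<open>C\<close> onto the eigenvector \<open>b\<close>, so
        the orthogonal complement of \<open>F\<close> is invariant and contains a further
        eigenvector.\<close>
      have inv: "C *v v \<in> ?W" if "v \<in> ?W" for v
      proof safe
        fix b assume b: "b \<in> F"
        have "b \<bullet> (C *v v) = (C *v b) \<bullet> v"
          by (rule symmetric_matrix_inner[OF sym])
        also have "\<dots> = 0"
          using that b by (subst F[OF b]) simp
        finally show "b \<bullet> (C *v v) = 0" .
      qed
      obtain u where "u \<noteq> 0" "\<And>y. y \<in> span F \<Longrightarrow> orthogonal u y"
        using orthogonal_to_subspace_exists_gen[of F UNIV] False by (auto simp: top.not_eq_extremum)
      then have "u \<in> ?W" "u \<noteq> 0"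
        by (auto simp: orthogonal_def inner_commute span_base)
      then have "?W \<noteq> {0}" by blast
      with sub obtain v where v: "v \<in> ?W" "norm v = 1" "C *v v = (v \<bullet> (C *v v)) *\<^sub>R v"
        by (rule symmetric_max_eigenvector[OF sym _ _ inv]) auto
      have "v \<notin> F"
        using v(1,2) by (force simp: dot_square_norm)
      have ins: "orthonormal_eigenvectors C (insert v F)"
        using less.prems v unfolding orthonormal_eigenvectors_def
        by (auto simp: pairwise_insert orthogonal_def inner_commute)
      have fin: "finite F" "finite (insert v F)"
        using less.prems orthonormal_eigenvectors_finite by auto
      have "card (insert v F) \<le> DIM(real^'n)"
        using orthonormal_eigenvectors_independent[OF ins] independent_card_le by blast
      with fin \<open>v \<notin> F\<close> have "DIM(real^'n) - card (insert v F) < DIM(real^'n) - card F"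
        by simp
      from less.hyps[OF this ins] show ?thesis by blast
    qed (use less.prems in auto)
  qed
  with that show thesis by blast
qed

lemma subspace_eigenspace: "subspace (eigenspace C l)"
  by (auto simp: subspace_def eigenspace_def matrix_vector_right_distrib
      matrix_vector_mult_scaleR scaleR_add_right)

text \<open>In the expansion of an eigenvector over \<open>F\<close>, the coefficient at any
  \<open>b\<close> with a different eigenvalue is 0 by symmetry, so the matching members of
  \<open>F\<close> form a basis of the eigenspace.\<close>

lemma dim_eigenspace_eq_card:
  fixes C :: "real^'n^'n"
  assumes sym: "transpose C = C" and F: "orthonormal_eigenvectors C F" "span F = UNIV"
  shows "dim (eigenspace C l) = card {b \<in> F. b \<bullet> (C *v b) = l}"
proof -
  let ?E = "{b \<in> F. b \<bullet> (C *v b) = l}"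
  have orth: "pairwise orthogonal F" "\<And>b. b \<in> F \<Longrightarrow> norm b = 1"
    and eig: "\<And>b. b \<in> F \<Longrightarrow> C *v b = (b \<bullet> (C *v b)) *\<^sub>R b"
    using F(1) by (auto simp: orthonormal_eigenvectors_def)
  have "span ?E = eigenspace C l"
  proof
    have "?E \<subseteq> eigenspace C l"
      using eig by (auto simp: eigenspace_def)
    then show "span ?E \<subseteq> eigenspace C l"
      by (rule span_minimal[OF _ subspace_eigenspace])
    show "eigenspace C l \<subseteq> span ?E"
    proof
      fix v assume "v \<in> eigenspace C l"
      then have v: "C *v v = l *\<^sub>R v" by (simp add: eigenspace_def)
      have zero: "v \<bullet> b = 0" if b: "b \<in> F" "b \<notin> ?E" for b
      proof -
        have "l * (v \<bullet> b) = (C *v v) \<bullet> b" by (simp add: v)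
        also have "\<dots> = v \<bullet> (C *v b)" by (rule symmetric_matrix_inner[OF sym, symmetric])
        also have "\<dots> = (b \<bullet> (C *v b)) * (v \<bullet> b)" by (subst eig[OF b(1)]) simp
        finally show ?thesis using b by simp
      qed
      have "v = (\<Sum>b\<in>F. (v \<bullet> b) *\<^sub>R b)"
        by (rule orthonormal_basis_expand[symmetric])
          (use orth F orthonormal_eigenvectors_finite in auto)
      also have "\<dots> \<in> span ?E"
      proof (rule span_sum)
        fix b assume "b \<in> F"
        then show "(v \<bullet> b) *\<^sub>R b \<in> span ?E"
          using zero[of b] by (cases "b \<in> ?E") (auto intro: span_mul span_base span_zero)
      qed
      finally show "v \<in> span ?E" .
    qed
  qed
  moreover have "independent ?E"
    using orthonormal_eigenvectors_independent[OF F(1)] by (rule independent_mono) auto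
  ultimately show ?thesis
    by (metis dim_eq_card_independent dim_span)
qed

lemma eigenvalues_iff_dim_pos: "l \<in> eigenvalues C \<longleftrightarrow> dim (eigenspace C l) \<noteq> 0"
  unfolding eigenvalues_def by (auto simp: dim_eq_0)

lemma eigenvalues_eq_image:
  fixes C :: "real^'n^'n"
  assumes "transpose C = C" "orthonormal_eigenvectors C F" "span F = UNIV"
  shows "eigenvalues C = (\<lambda>b. b \<bullet> (C *v b)) ` F"
  using orthonormal_eigenvectors_finite[OF assms(2)]
  by (auto simp: eigenvalues_iff_dim_pos dim_eigenspace_eq_card[OF assms] card_eq_0_iff)

lemma finite_eigenvalues:
  fixes C :: "real^'n^'n"
  assumes sym: "transpose C = C"
  shows "finite (eigenvalues C)"
proof -
  have "orthonormal_eigenvectors C {}"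
    by (simp add: orthonormal_eigenvectors_def)
  then obtain F where F: "orthonormal_eigenvectors C F" "span F = UNIV"
    using orthonormal_eigenvectors_extend_to_basis[OF sym] by metis
  then show ?thesis
    using eigenvalues_eq_image[OF sym F] orthonormal_eigenvectors_finite[OF F(1)] by simp
qed

text \<open>The maximum of the Rayleigh quotient is itself an eigenvalue, hence at most the largest
  one.\<close>

lemma quadratic_form_le_largest_eigenvalue:
  fixes C :: "real^'n^'n"
  assumes sym: "transpose C = C"
  shows "u \<bullet> (C *v u) \<le> largest_eigenvalue C * (u \<bullet> u)"
proof -
  have "(UNIV :: (real^'n) set) \<noteq> {0}"
    using UNIV_not_singleton by blast
  then obtain v where v: "norm v = 1" "C *v v = (v \<bullet> (C *v v)) *\<^sub>R v"
    "\<And>u. u \<bullet> (C *v u) \<le> (v \<bullet> (C *v v)) * (u \<bullet> u)"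
    using symmetric_max_eigenvector[OF sym subspace_UNIV] by (metis UNIV_I)
  have "v \<noteq> 0" using v(1) by auto
  then have "v \<bullet> (C *v v) \<in> eigenvalues C"
    using v(2) unfolding eigenvalues_def eigenspace_def by blast
  then have "v \<bullet> (C *v v) \<le> largest_eigenvalue C"
    unfolding largest_eigenvalue_def using finite_eigenvalues[OF sym] by simp
  then have "(v \<bullet> (C *v v)) * (u \<bullet> u) \<le> largest_eigenvalue C * (u \<bullet> u)"
    by (intro mult_right_mono) auto
  with v(3)[of u] show ?thesis by linarith
qed

section \<open>Sums over the spectrum with multiplicity\<close>

definition spectral_sum :: "(real \<Rightarrow> int) \<Rightarrow> real^'n^'n \<Rightarrow> int" where
  "spectral_sum f C = (\<Sum>l\<in>eigenvalues C. int (dim (eigenspace C l)) * f l)"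

text \<open>Grouping \<open>F\<close> by eigenvalue gives the multiplicities. Every eigenbasis
  yields the same number, so two matrices can be compared in a common one.\<close>

lemma spectral_sum_eq_sum_basis:
  fixes C :: "real^'n^'n"
  assumes "transpose C = C" "orthonormal_eigenvectors C F" "span F = UNIV"
  shows "spectral_sum f C = (\<Sum>b\<in>F. f (b \<bullet> (C *v b)))"
proof -
  have "(\<Sum>b\<in>F. f (b \<bullet> (C *v b)))
      = (\<Sum>l\<in>eigenvalues C. \<Sum>b\<in>{b \<in> F. b \<bullet> (C *v b) = l}. f (b \<bullet> (C *v b)))"
    unfolding eigenvalues_eq_image[OF assms]
    by (rule sum.image_gen[OF orthonormal_eigenvectors_finite[OF assms(2)]])
  then show ?thesis
    by (simp add: spectral_sum_def dim_eigenspace_eq_card[OF assms])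
qed

text \<open>An eigenbasis of \<open>C\<close> containing \<open>a\<close> is also one of
  \<open>C'\<close>: the update vanishes on vectors orthogonal to \<open>a\<close> and lowers the
  eigenvalue at \<open>a\<close> by \<open>r\<close>.\<close>

lemma spectral_sum_rank_one_update:
  fixes C C' :: "real^'n^'n"
  assumes sym: "transpose C = C" "transpose C' = C'"
    and a: "norm a = 1" "C *v a = l *\<^sub>R a"
    and C': "\<And>v. C' *v v = C *v v - (r * (a \<bullet> v)) *\<^sub>R a"
  shows "spectral_sum f C' = spectral_sum f C - f l + f (l - r)"
proof -
  have aa: "a \<bullet> a = 1" using a(1) by (simp add: dot_square_norm)
  have "orthonormal_eigenvectors C {a}"
    using a by (simp add: orthonormal_eigenvectors_def aa)
  then obtain F where F: "a \<in> F" "orthonormal_eigenvectors C F" "span F = UNIV"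
    using orthonormal_eigenvectors_extend_to_basis[OF sym(1)] by (metis insert_subset)
  have fin: "finite F" by (rule orthonormal_eigenvectors_finite[OF F(2)])
  have other: "C' *v b = C *v b" if "b \<in> F - {a}" for b
  proof -
    have "orthogonal a b"
      using that F by (auto simp: orthonormal_eigenvectors_def pairwise_def)
    then show ?thesis by (simp add: C' orthogonal_def)
  qed
  have C'a: "C' *v a = (l - r) *\<^sub>R a"
    by (simp add: C' a aa scaleR_diff_left)
  have "orthonormal_eigenvectors C' F"
    unfolding orthonormal_eigenvectors_def
  proof (intro conjI ballI)
    fix b assume b: "b \<in> F"
    show "C' *v b = (b \<bullet> (C' *v b)) *\<^sub>R b"
    proof (cases "b = a")
      case False
      then show ?thesis
        using F(2) b other[of b] by (simp add: orthonormal_eigenvectors_def)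
    qed (simp add: C'a aa)
  qed (use F in \<open>auto simp: orthonormal_eigenvectors_def\<close>)
  then have "spectral_sum f C' = (\<Sum>b\<in>F. f (b \<bullet> (C' *v b)))"
    using sym F by (intro spectral_sum_eq_sum_basis)
  also have "\<dots> = f (l - r) + (\<Sum>b\<in>F - {a}. f (b \<bullet> (C *v b)))"
    using fin F(1) by (simp add: sum.remove[of F a] C'a aa other)
  also have "(\<Sum>b\<in>F - {a}. f (b \<bullet> (C *v b))) = spectral_sum f C - f l"
    using fin F sym by (simp add: spectral_sum_eq_sum_basis sum.remove[of F a] a aa)
  finally show ?thesis by simp
qed

text \<open>The spectral sum includes the eigenvalue 0, which \<open>lam\<close> omits;
  \<open>f 0 = 0\<close> reconciles them.\<close>

lemma spectral_sum_eq_sum_eigenvalues_with_mult: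
  fixes C :: "real^'n^'n"
  assumes sym: "transpose C = C" and lam: "nonzero_eigenvalues_with_mult C k lam" and "f 0 = 0"
  shows "spectral_sum f C = (\<Sum>i\<in>{1..k}. f (lam i))"
proof -
  have nz: "lam i \<noteq> 0" if "i \<in> {1..k}" for i
    using lam that by (simp add: nonzero_eigenvalues_with_mult_def)
  have card: "card {i \<in> {1..k}. lam i = l} = dim (eigenspace C l)" if "l \<noteq> 0" for l
    using lam that by (simp add: nonzero_eigenvalues_with_mult_def)
  have img: "lam ` {1..k} = eigenvalues C - {0}"
  proof (intro set_eqI iffI)
    fix l assume "l \<in> lam ` {1..k}"
    then have "l \<noteq> 0" "{i \<in> {1..k}. lam i = l} \<noteq> {}"
      using nz by auto
    then show "l \<in> eigenvalues C - {0}"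
      using card[of l] by (simp add: eigenvalues_iff_dim_pos card_eq_0_iff flip: card)
  next
    fix l assume "l \<in> eigenvalues C - {0}"
    then have "card {i \<in> {1..k}. lam i = l} \<noteq> 0"
      using card[of l] eigenvalues_iff_dim_pos[of l C] by simp
    then have "{i \<in> {1..k}. lam i = l} \<noteq> {}"
      by (metis card.empty)
    then show "l \<in> lam ` {1..k}" by auto
  qed
  have "(\<Sum>i\<in>{1..k}. f (lam i)) = (\<Sum>l\<in>lam ` {1..k}. \<Sum>i\<in>{i \<in> {1..k}. lam i = l}. f (lam i))"
    by (rule sum.image_gen) simp
  also have "\<dots> = (\<Sum>l\<in>eigenvalues C - {0}. int (dim (eigenspace C l)) * f l)"
    unfolding img by (intro sum.cong refl) (auto simp flip: card)
  also have "\<dots> = spectral_sum f C"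
    unfolding spectral_sum_def
    by (rule sum.mono_neutral_left) (use finite_eigenvalues[OF sym] \<open>f 0 = 0\<close> in auto)
  finally show ?thesis by simp
qed

subsection \<open>Iterations of the algorithm\<close>

lemma transpose_transpose_mult_self: "transpose (A ** transpose A) = A ** transpose A"
  for A :: "real^'n^'n"
  by (simp add: matrix_transpose_mul)

text \<open>Symmetry turns the row factor into the transpose of \<open>g\<close>, so the correction
  is the outer product of \<open>g\<close> with itself.\<close>

lemma ig_cov_Suc:
  fixes S :: "real^'n^'n"
  assumes "transpose (ig_cov \<sigma> S d i) = ig_cov \<sigma> S d i"
  defines "g \<equiv> ig_cov \<sigma> S d i *v d i"
  shows "ig_cov \<sigma> S d (Suc i) = ig_cov \<sigma> S d i - inverse (d i \<bullet> g + \<sigma>\<^sup>2) *\<^sub>R (\<chi> r s. g $ r * g $ s)"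
proof -
  have "d i v* ig_cov \<sigma> S d i = g"
    using transpose_matrix_vector[of "ig_cov \<sigma> S d i" "d i"] assms(1) by (simp add: g_def)
  then have "(columnvector g :: real^1^'n) ** (rowvector (d i v* ig_cov \<sigma> S d i) :: real^'n^1) = (\<chi> r s. g $ r * g $ s)"
    by (simp add: vec_eq_iff matrix_mult_nth columnvector_def rowvector_def)
  then show ?thesis
    by (simp add: Let_def g_def)
qed

lemma transpose_ig_cov:
  fixes S :: "real^'n^'n"
  assumes "transpose S = S"
  shows "transpose (ig_cov \<sigma> S d i) = ig_cov \<sigma> S d i"
proof (induction i)
  case (Suc i)
  have "ig_cov \<sigma> S d i $ r $ s = ig_cov \<sigma> S d i $ s $ r" for r s
    using arg_cong[OF Suc, of "\<lambda>A. A $ s $ r"] by (simp add: transpose_def)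
  then show ?case
    unfolding ig_cov_Suc[OF Suc] by (simp add: transpose_def vec_eq_iff mult.commute)
qed (simp add: assms)

lemma outer_product_vector_mult: "(\<chi> r s. u $ r * v $ s) *v z = (v \<bullet> z) *\<^sub>R u" for v :: "real^'n"
  by (simp add: vec_eq_iff matrix_vector_mult_def inner_vec_def sum_distrib_left mult_ac)

lemma ig_cov_Suc_vector:
  fixes S :: "real^'n^'n" and \<sigma> :: real and d :: "nat \<Rightarrow> real^'n" and i :: nat
  assumes "transpose S = S"
  defines "g \<equiv> ig_cov \<sigma> S d i *v d i"
  shows "ig_cov \<sigma> S d (Suc i) *v v
    = ig_cov \<sigma> S d i *v v - (inverse (d i \<bullet> g + \<sigma>\<^sup>2) * (g \<bullet> v)) *\<^sub>R g"
proof -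
  show ?thesis
    unfolding ig_cov_Suc[OF transpose_ig_cov[OF assms(1)]] g_def
    by (simp add: matrix_vector_mult_diff_rdistrib scaleR_matrix_vector_assoc[symmetric] outer_product_vector_mult)
qed

text \<open>The Joseph form of the covariance update, which makes it visible as the covariance of a
  linear image of the old error plus independent noise.\<close>

lemma joseph_form:
  fixes C :: "real^'n^'n"
  assumes sym: "transpose C = C" and D: "a \<bullet> (C *v a) + \<sigma>\<^sup>2 \<noteq> 0"
  defines "g \<equiv> C *v a"
  defines "K \<equiv> inverse (a \<bullet> g + \<sigma>\<^sup>2) *\<^sub>R g"
  defines "P \<equiv> mat 1 - (\<chi> r s. K $ r * a $ s)"
  shows "P ** C ** transpose P + \<sigma>\<^sup>2 *\<^sub>R (\<chi> r s. (- K) $ r * (- K) $ s)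
    = C - inverse (a \<bullet> g + \<sigma>\<^sup>2) *\<^sub>R (\<chi> r s. g $ r * g $ s)"
proof -
  have sym': "C $ r $ s = C $ s $ r" for r s
    using arg_cong[OF sym, of "\<lambda>A. A $ s $ r"] by (simp add: transpose_def)
  have g: "(\<Sum>s\<in>UNIV. a $ s * C $ s $ j) = g $ j" "(\<Sum>s\<in>UNIV. C $ j $ s * a $ s) = g $ j" for j
    by (simp_all add: g_def matrix_vector_mult_def sym'[of _ j] mult.commute)
  have ag: "(\<Sum>s\<in>UNIV. g $ s * a $ s) = a \<bullet> g"
    by (simp add: inner_vec_def mult.commute)
  have P: "P $ r $ s = (if r = s then 1 else 0) - K $ r * a $ s" for r s
    by (simp add: P_def mat_def)
  have PC: "(P ** C) $ r $ s = C $ r $ s - K $ r * g $ s" for r s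
    by (simp add: matrix_mult_nth P left_diff_distrib sum_subtractf if_distrib[of "\<lambda>x. x * _"]
        mult.assoc sum_distrib_left[symmetric] g cong: if_cong)
  have "(P ** C ** transpose P) $ r $ s
      = C $ r $ s - K $ r * g $ s - K $ s * g $ r + K $ r * K $ s * (a \<bullet> g)" for r s
  proof -
    have "(P ** C ** transpose P) $ r $ s
        = (\<Sum>t\<in>UNIV. (C $ r $ t - K $ r * g $ t) * ((if s = t then 1 else 0) - K $ s * a $ t))"
      by (simp add: matrix_mult_nth[of "P ** C"] PC transpose_def P)
    also have "\<dots> = (\<Sum>t\<in>UNIV. (C $ r $ t - K $ r * g $ t) * (if s = t then 1 else 0))
        - K $ s * (\<Sum>t\<in>UNIV. C $ r $ t * a $ t) + K $ r * K $ s * (\<Sum>t\<in>UNIV. g $ t * a $ t)"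
      by (simp add: sum_distrib_left sum_subtractf[symmetric] sum.distrib[symmetric] algebra_simps)
    finally show ?thesis
      by (simp add: g ag if_distrib[of "\<lambda>x. _ * x"] cong: if_cong)
  qed
  moreover have "C $ r $ s - K $ r * g $ s - K $ s * g $ r + K $ r * K $ s * (a \<bullet> g) + \<sigma>\<^sup>2 * (K $ r * K $ s)
      = C $ r $ s - inverse (a \<bullet> g + \<sigma>\<^sup>2) * (g $ r * g $ s)" for r s
  proof -
    \<comment> \<open>Since \<open>q\<close> inverts the denominator, the two terms quadratic in
      \<open>K\<close> add up to \<open>q * g $ r * g $ s\<close>, which cancels one of the two
      equal mixed terms.\<close>
    define q where "q = inverse (a \<bullet> g + \<sigma>\<^sup>2)"
    have "q * (a \<bullet> g + \<sigma>\<^sup>2) = 1"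
      using D by (simp add: q_def g_def)
    then have "q * g $ r * (q * g $ s) * (a \<bullet> g) + \<sigma>\<^sup>2 * (q * g $ r * (q * g $ s)) = q * g $ r * g $ s"
      by algebra
    then show ?thesis
      by (simp add: K_def q_def[symmetric] algebra_simps)
  qed
  ultimately show ?thesis
    by (simp add: vec_eq_iff)
qed

section \<open>The law of the estimation error\<close>

lemma ig_mean_cong:
  "(\<And>j. j < i \<Longrightarrow> y j = y' j) \<Longrightarrow> ig_mean \<sigma> m S d y i = ig_mean \<sigma> m S d y' i"
  by (induction i) (simp_all add: Let_def)

lemma measurable_ig_mean:
  fixes m :: "real^'n"
  assumes "\<And>j. j < i \<Longrightarrow> y j \<in> borel_measurable M"
  shows "(\<lambda>\<omega>. ig_mean \<sigma> m S d (\<lambda>j. y j \<omega>) i) \<in> borel_measurable M"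
  using assms
proof (induction i)
  case (Suc i)
  then have [measurable]: "y i \<in> borel_measurable M"
    "(\<lambda>\<omega>. ig_mean \<sigma> m S d (\<lambda>j. y j \<omega>) i) \<in> borel_measurable M" by simp_all
  show ?case by (simp add: Let_def)
qed simp

text \<open>Disjoint index blocks of an independent family are independent, also after a measurable
  map; the estimation error enters as \<open>F\<close> of the prefix.\<close>

lemma (in prob_space) indep_var_prefix_next:
  fixes X :: "nat \<Rightarrow> 'a \<Rightarrow> 'b"
  assumes X: "indep_vars (\<lambda>_. N) X UNIV" and F: "F \<in> (\<Pi>\<^sub>M j\<in>{..i}. N) \<rightarrow>\<^sub>M N'"
  shows "indep_var N' (\<lambda>\<omega>. F (\<lambda>j\<in>{..i}. X j \<omega>)) N (X (Suc i))"
proof -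
  have "indep_var (\<Pi>\<^sub>M j\<in>{..i}. N) (\<lambda>\<omega>. \<lambda>j\<in>{..i}. X j \<omega>) (\<Pi>\<^sub>M j\<in>{Suc i}. N) (\<lambda>\<omega>. \<lambda>j\<in>{Suc i}. X j \<omega>)"
    by (rule indep_var_restrict[OF X]) auto
  from indep_var_compose[OF this F, of "\<lambda>g. g (Suc i)" N] show ?thesis
    by (simp add: o_def)
qed

lemma (in prob_space) ig_error_law:
  fixes x :: "'a \<Rightarrow> real^'n" and w :: "nat \<Rightarrow> 'a \<Rightarrow> real^'n"
  assumes signal: "normal_vector M x \<mu> S"
    and noise: "\<And>i. normal_vector M (w i) 0 (mat (\<sigma>\<^sup>2))"
    and indep: "indep_vars (\<lambda>_. borel) (\<lambda>j. case j of 0 \<Rightarrow> x | Suc i \<Rightarrow> w i) (UNIV :: nat set)"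
    and unit: "\<And>i. i < N \<Longrightarrow> norm (d i) = 1"
    and nz: "\<And>i. i < N \<Longrightarrow> d i \<bullet> (ig_cov \<sigma> S d i *v d i) + \<sigma>\<^sup>2 \<noteq> 0"
  shows "\<exists>B. B ** transpose B = ig_cov \<sigma> S d N \<and>
    distr M borel (\<lambda>\<omega>. x \<omega> - ig_mean \<sigma> \<mu> S d (\<lambda>i. d i \<bullet> (x \<omega> + w i \<omega>)) N) = affine_std_normal 0 B"
  using unit nz
proof (induction N)
  case 0
  obtain A where A: "S = A ** transpose A" "distr M borel x = affine_std_normal \<mu> A"
    using signal by (auto simp: normal_vector_def)
  have [measurable]: "x \<in> borel_measurable M"
    using signal by (simp add: normal_vector_def)
  have "distr M borel (\<lambda>\<omega>. x \<omega> - \<mu>) = distr (distr M borel x) borel (\<lambda>v. v - \<mu>)"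
    by (subst distr_distr) (auto simp: o_def)
  also have "\<dots> = affine_std_normal 0 A"
    unfolding A(2) affine_std_normal_eq_distr by (subst distr_distr) (auto simp: o_def)
  finally show ?case using A(1) by auto
next
  case (Suc i)
  let ?e = "\<lambda>i \<omega>. x \<omega> - ig_mean \<sigma> \<mu> S d (\<lambda>i. d i \<bullet> (x \<omega> + w i \<omega>)) i"
  define C where "C = ig_cov \<sigma> S d i"
  define g where "g = C *v d i"
  define K where "K = inverse (d i \<bullet> g + \<sigma>\<^sup>2) *\<^sub>R g"
  define P where "P = mat 1 - (\<chi> r s. K $ r * d i $ s)"
  \<comment> \<open>Index 0 carries the signal and \<open>Suc j\<close> the noise of measurement
    \<open>j\<close>. The prefix \<open>{..i}\<close> thus holds exactly the data of the first
    \<open>i\<close> measurements, and the next entry is the fresh \<open>w i\<close>.\<close>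
  define F where "F = (\<lambda>h :: nat \<Rightarrow> real^'n. h 0 - ig_mean \<sigma> \<mu> S d (\<lambda>j. d j \<bullet> (h 0 + h (Suc j))) i)"
  obtain B where B: "B ** transpose B = C" "distr M borel (?e i) = affine_std_normal 0 B"
    using Suc unfolding C_def by fastforce
  have sym: "transpose C = C"
    using transpose_transpose_mult_self[of B] by (simp add: B(1))
  have [measurable]: "(\<lambda>h :: nat \<Rightarrow> real^'n. h j) \<in> borel_measurable (\<Pi>\<^sub>M j\<in>{..i}. borel)" if "j \<le> i" for j
    using that by simp
  have "F \<in> borel_measurable (\<Pi>\<^sub>M j\<in>{..i}. borel)"
    unfolding F_def
    by (intro borel_measurable_diff measurable_ig_mean borel_measurable_inner borel_measurable_add) auto
  from indep_var_prefix_next[OF indep this]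
  have "indep_var borel (\<lambda>\<omega>. F (\<lambda>j\<in>{..i}. case j of 0 \<Rightarrow> x \<omega> | Suc j \<Rightarrow> w j \<omega>)) borel (w i)"
    by (simp add: nat.case_distrib[of "\<lambda>f. f _"] cong: nat.case_cong)
  moreover have "F (\<lambda>j\<in>{..i}. case j of 0 \<Rightarrow> x \<omega> | Suc j \<Rightarrow> w j \<omega>) = ?e i \<omega>" for \<omega>
    by (auto simp: F_def intro!: ig_mean_cong)
  ultimately have "indep_var borel (?e i) borel (w i)"
    by simp
  then obtain B' :: "real^'n^'n" where B': "distr M borel (\<lambda>\<omega>. P *v ?e i \<omega> + (d i \<bullet> w i \<omega>) *\<^sub>R - K) = affine_std_normal 0 B'"
    "B' ** transpose B' = P ** (B ** transpose B) ** transpose P + \<sigma>\<^sup>2 *\<^sub>R (\<chi> r s. (- K) $ r * (- K) $ s)"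
    by (rule normal_linear_plus_noise[OF _ B(2) noise Suc.prems(1)[OF lessI], where P = P and k = "- K"])
  have P: "P *v v = v - (d i \<bullet> v) *\<^sub>R K" for v
    by (simp add: P_def matrix_vector_mult_diff_rdistrib outer_product_vector_mult)
  have mean: "ig_mean \<sigma> \<mu> S d y (Suc i)
      = ig_mean \<sigma> \<mu> S d y i + (y i - d i \<bullet> ig_mean \<sigma> \<mu> S d y i) *\<^sub>R K" for y
    by (simp add: Let_def K_def g_def C_def mult.commute)
  \<comment> \<open>The innovation, outcome minus prediction, equals \<open>d i\<close> applied to
    the old error plus \<open>d i \<bullet> w i \<omega>\<close>, so signal and mean enter only
    through their difference.\<close>
  have "?e (Suc i) \<omega> = P *v ?e i \<omega> + (d i \<bullet> w i \<omega>) *\<^sub>R - K" for \<omega>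
    unfolding P mean
    by (simp add: inner_diff_right inner_add_right scaleR_diff_left scaleR_add_left)
  moreover have "B' ** transpose B' = ig_cov \<sigma> S d (Suc i)"
    using joseph_form[OF sym, of "d i" \<sigma>] Suc.prems(2)[of i]
    by (simp add: B'(2) B(1) ig_cov_Suc sym C_def[symmetric] g_def[symmetric] K_def[symmetric]
        P_def[symmetric] del: ig_cov.simps)
  ultimately show ?case
    using B'(1) by (intro exI[of _ B']) simp
qed

section \<open>Counting the measurements\<close>

lemma spectral_sum_nonneg: "(\<And>l. 0 \<le> f l) \<Longrightarrow> 0 \<le> spectral_sum f C"
  unfolding spectral_sum_def by (intro sum_nonneg mult_nonneg_nonneg) auto

text \<open>A measurement along a top eigenvector replaces the eigenvalue \<open>l\<close> by
  \<open>l \<sigma>\<^sup>2 / (l + \<sigma>\<^sup>2)\<close>, that is, adds \<open>1 / \<sigma>\<^sup>2\<close> to its inverse.\<close>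

lemma spectral_sum_ig_cov:
  fixes S :: "real^'n^'n" and f :: "real \<Rightarrow> int"
  assumes sym: "transpose S = S" and dirs: "ig_directions \<sigma> thr S d" and "0 < thr"
    and f: "\<And>l. thr < l \<Longrightarrow> f (l * \<sigma>\<^sup>2 / (l + \<sigma>\<^sup>2)) = f l - 1"
    and "\<And>j. j < n \<Longrightarrow> thr < largest_eigenvalue (ig_cov \<sigma> S d j)"
  shows "spectral_sum f (ig_cov \<sigma> S d n) = spectral_sum f S - int n"
  using assms(5)
proof (induction n)
  case (Suc n)
  let ?C = "ig_cov \<sigma> S d n"
  define l where "l = largest_eigenvalue ?C"
  have l: "thr < l"
    using Suc.prems by (simp add: l_def)
  have a: "norm (d n) = 1" "?C *v d n = l *\<^sub>R d n"
    using dirs Suc.prems unfolding ig_directions_def l_def eigenspace_def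
    by (auto simp: less_Suc_eq_le)
  have pos: "0 < l + \<sigma>\<^sup>2"
    using l \<open>0 < thr\<close> by (intro add_pos_nonneg) auto
  \<comment> \<open>As \<open>d n\<close> is an eigenvector for \<open>l\<close>, the gain direction
    is \<open>l\<close> times \<open>d n\<close>, and the subtracted amount is
    \<open>r = l^2 / (l + \<sigma>^2)\<close>.\<close>
  have "spectral_sum f (ig_cov \<sigma> S d (Suc n))
      = spectral_sum f ?C - f l + f (l - inverse (l + \<sigma>\<^sup>2) * l * l)"
  proof (rule spectral_sum_rank_one_update)
    show "ig_cov \<sigma> S d (Suc n) *v v = ?C *v v - (inverse (l + \<sigma>\<^sup>2) * l * l * (d n \<bullet> v)) *\<^sub>R d n" for v
      unfolding ig_cov_Suc_vector[OF sym] using a by (simp add: dot_square_norm mult_ac)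
    show "transpose (ig_cov \<sigma> S d (Suc n)) = ig_cov \<sigma> S d (Suc n)"
      by (rule transpose_ig_cov[OF sym])
  qed (use a transpose_ig_cov[OF sym] in auto)
  also have "l - inverse (l + \<sigma>\<^sup>2) * l * l = l * \<sigma>\<^sup>2 / (l + \<sigma>\<^sup>2)"
    using pos by (simp add: field_simps)
  finally show ?case
    using Suc f[OF l] by simp
qed simp

lemma ig_stops_after_le_spectral_sum:
  fixes S :: "real^'n^'n" and f :: "real \<Rightarrow> int"
  assumes "transpose S = S" "ig_directions \<sigma> thr S d" "0 < thr"
    and "\<And>l. thr < l \<Longrightarrow> f (l * \<sigma>\<^sup>2 / (l + \<sigma>\<^sup>2)) = f l - 1" and "\<And>l. 0 \<le> f l"
    and "ig_stops_after \<sigma> thr S d N"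
  shows "int N \<le> spectral_sum f S"
  using spectral_sum_ig_cov[of S \<sigma> thr d f N] spectral_sum_nonneg[of f "ig_cov \<sigma> S d N"] assms
  by (simp add: ig_stops_after_def)

lemma ig_stops_after_exists:
  fixes S :: "real^'n^'n" and f :: "real \<Rightarrow> int"
  assumes "transpose S = S" "ig_directions \<sigma> thr S d" "0 < thr"
    and "\<And>l. thr < l \<Longrightarrow> f (l * \<sigma>\<^sup>2 / (l + \<sigma>\<^sup>2)) = f l - 1" and f: "\<And>l. 0 \<le> f l"
  shows "\<exists>N. ig_stops_after \<sigma> thr S d N"
proof -
  have "\<exists>n. largest_eigenvalue (ig_cov \<sigma> S d n) \<le> thr"
  proof (rule ccontr)
    assume "\<not> ?thesis"
    then have "spectral_sum f (ig_cov \<sigma> S d n) = spectral_sum f S - int n" for n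
      using assms by (intro spectral_sum_ig_cov) (auto simp: not_le)
    moreover have "0 \<le> spectral_sum f (ig_cov \<sigma> S d n)" for n
      using f by (rule spectral_sum_nonneg)
    ultimately have "int n \<le> spectral_sum f S" for n
      by (metis diff_ge_0_iff_ge)
    from this[of "nat (spectral_sum f S) + 1"] show False by (simp split: if_splits)
  qed
  then obtain N where "largest_eigenvalue (ig_cov \<sigma> S d N) \<le> thr"
    "\<forall>j<N. \<not> largest_eigenvalue (ig_cov \<sigma> S d j) \<le> thr"
    using exists_least_iff[of "\<lambda>n. largest_eigenvalue (ig_cov \<sigma> S d n) \<le> thr"] by blast
  then show ?thesis
    unfolding ig_stops_after_def by (intro exI[of _ N]) auto
qed

text \<open>The inverse of the eigenvalue grows by 1 / \<sigma>^2, so the argument of the ceiling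
  drops by exactly 1. Because \<open>1 / l < q\<close>, the old ceiling is at least 1 and the
  truncation at 0 does not interfere.\<close>

lemma ceiling_measurements_drop:
  fixes q \<sigma> l :: real
  assumes "0 < \<sigma>" "0 < l" "1 / l < q"
  defines "f \<equiv> \<lambda>l. if l \<le> 0 then 0 else max 0 \<lceil>(q - 1 / l) * \<sigma>\<^sup>2\<rceil>"
  shows "f (l * \<sigma>\<^sup>2 / (l + \<sigma>\<^sup>2)) = f l - 1"
proof -
  have s: "0 < \<sigma>\<^sup>2" using \<open>0 < \<sigma>\<close> by simp
  have "0 < l * \<sigma>\<^sup>2 / (l + \<sigma>\<^sup>2)"
    using s \<open>0 < l\<close> by (intro divide_pos_pos mult_pos_pos add_pos_pos) auto
  moreover have "(q - 1 / (l * \<sigma>\<^sup>2 / (l + \<sigma>\<^sup>2))) * \<sigma>\<^sup>2 = (q - 1 / l) * \<sigma>\<^sup>2 - 1"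
    using s \<open>0 < l\<close> by (simp add: field_simps)
  moreover have "0 < \<lceil>(q - 1 / l) * \<sigma>\<^sup>2\<rceil>"
    using s assms(3) by (simp add: zero_less_mult_iff)
  moreover have "\<lceil>(q - 1 / l) * \<sigma>\<^sup>2 - 1\<rceil> = \<lceil>(q - 1 / l) * \<sigma>\<^sup>2\<rceil> - 1"
    by linarith
  ultimately show ?thesis
    using \<open>0 < l\<close> by (simp add: f_def)
qed

text \<open>For \<open>l\<close> above the threshold the argument lies in the half-open interval
  from 0 to \<sigma>^2 / thr \<le> 1, so its ceiling is 1; otherwise it is at most 0.\<close>

lemma ceiling_measurements_eq_indicator:
  fixes thr \<sigma> l :: real
  assumes "0 < thr" "0 < \<sigma>" "\<sigma>\<^sup>2 \<le> thr" "0 < l"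
  shows "max 0 \<lceil>(1 / thr - 1 / l) * \<sigma>\<^sup>2\<rceil> = (if thr < l then 1 else 0)"
proof (cases "thr < l")
  case True
  have "0 < (1 / thr - 1 / l) * \<sigma>\<^sup>2"
    using True assms by (simp add: field_simps)
  moreover have "(1 / thr - 1 / l) * \<sigma>\<^sup>2 \<le> (1 / thr) * thr"
    using True assms by (intro mult_mono) (auto simp: field_simps)
  ultimately have "\<lceil>(1 / thr - 1 / l) * \<sigma>\<^sup>2\<rceil> = 1"
    using assms by (simp add: ceiling_eq_iff)
  with True show ?thesis by simp
next
  case False
  then have "(1 / thr - 1 / l) * \<sigma>\<^sup>2 \<le> 0"
    using assms by (intro mult_nonpos_nonneg) (auto simp: field_simps)
  then have "\<lceil>(1 / thr - 1 / l) * \<sigma>\<^sup>2\<rceil> \<le> 0"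
    by (simp add: ceiling_le_iff)
  with False show ?thesis by simp
qed

text \<open>If \<sigma>^2 \<le> thr, one measurement brings an eigenvalue to the threshold or below,
  \<sigma> = 0 included; hence the indicator drops.\<close>

lemma updated_eigenvalue_le:
  fixes l \<sigma> :: real
  assumes "0 < l"
  shows "l * \<sigma>\<^sup>2 / (l + \<sigma>\<^sup>2) \<le> \<sigma>\<^sup>2"
proof -
  have "0 < l + \<sigma>\<^sup>2" using assms by (intro add_pos_nonneg) auto
  then show ?thesis by (simp add: pos_divide_le_eq algebra_simps)
qed

text \<open>The quadratic form of \<open>A ** transpose A\<close> is a square. Positivity places
  every \<open>lam i\<close> in the branch of the count that carries the ceiling formula.\<close>

lemma nonzero_eigenvalue_of_psd_pos:
  fixes A :: "real^'n^'n"
  assumes lam: "nonzero_eigenvalues_with_mult (A ** transpose A) k lam" and i: "i \<in> {1..k}"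
  shows "0 < lam i"
proof -
  let ?S = "A ** transpose A"
  have nz: "lam i \<noteq> 0"
    using lam i by (simp add: nonzero_eigenvalues_with_mult_def)
  have "dim (eigenspace ?S (lam i)) = card {j \<in> {1..k}. lam j = lam i}"
    using lam nz by (simp add: nonzero_eigenvalues_with_mult_def)
  also have "\<dots> \<noteq> 0"
    using i by (auto simp: card_eq_0_iff)
  finally obtain v where v: "?S *v v = lam i *\<^sub>R v" "v \<noteq> 0"
    by (auto simp: dim_eq_0 eigenspace_def)
  have "lam i * (v \<bullet> v) = v \<bullet> (?S *v v)"
    by (simp add: v(1))
  also have "\<dots> = (transpose A *v v) \<bullet> (transpose A *v v)"
    by (simp add: matrix_vector_mul_assoc[symmetric] dot_lmul_matrix[symmetric])
  finally have "0 \<le> lam i * (v \<bullet> v)"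
    by simp
  moreover have "0 < v \<bullet> v"
    using v(2) by simp
  ultimately have "0 \<le> lam i"
    by (simp only: zero_le_mult_iff) linarith
  with nz show ?thesis by simp
qed

theorem mainTheorem5:
  fixes M :: "'a measure"
    and x :: "'a \<Rightarrow> real^'n" and w :: "nat \<Rightarrow> 'a \<Rightarrow> real^'n"
    and \<mu> :: "real^'n" and S :: "real^'n^'n"
    and k :: nat and lam :: "nat \<Rightarrow> real"
    and \<epsilon> p \<sigma> c :: real
    and d :: "nat \<Rightarrow> real^'n"
  assumes "prob_space M"
    and signal: "normal_vector M x \<mu> S"
    and noise: "\<And>i. normal_vector M (w i) 0 (mat (\<sigma>\<^sup>2))"
    and indep: "prob_space.indep_vars M (\<lambda>_. borel)
                  (\<lambda>j. case j of 0 \<Rightarrow> x | Suc i \<Rightarrow> w i) (UNIV :: nat set)"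
    and "k = rank S"
    and "nonzero_eigenvalues_with_mult S k lam"
    and "\<epsilon> > 0" and "0 < p" and "p < 1" and "\<sigma> \<ge> 0"
    and c: "c = quantile (chi_squared CARD('n)) p"
    and directions: "ig_directions \<sigma> (\<epsilon>\<^sup>2 / c) S d"
  shows "\<exists>N. ig_stops_after \<sigma> (\<epsilon>\<^sup>2 / c) S d N \<and>
           measure M {\<omega> \<in> space M.
             norm (x \<omega> - ig_mean \<sigma> \<mu> S d (\<lambda>i. d i \<bullet> (x \<omega> + w i \<omega>)) N) < \<epsilon>} \<ge> p \<and>
           (\<sigma> > 0 \<longrightarrow>
             int N \<le> (\<Sum>i\<in>{i\<in>{1..k}. lam i \<noteq> 0}. max 0 \<lceil>(c / \<epsilon>\<^sup>2 - 1 / lam i) * \<sigma>\<^sup>2\<rceil>)) \<and>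
           (\<sigma> > 0 \<and> \<sigma>\<^sup>2 \<le> \<epsilon>\<^sup>2 / c \<longrightarrow>
             (\<Sum>i\<in>{i\<in>{1..k}. lam i \<noteq> 0}. max 0 \<lceil>(c / \<epsilon>\<^sup>2 - 1 / lam i) * \<sigma>\<^sup>2\<rceil>)
               = int (card {i\<in>{1..k}. lam i > \<epsilon>\<^sup>2 / c})) \<and>
           (\<sigma>\<^sup>2 \<le> \<epsilon>\<^sup>2 / c \<longrightarrow> N \<le> card {i\<in>{1..k}. lam i > \<epsilon>\<^sup>2 / c})"
proof -
  interpret prob_space M by fact
  have c0: "0 < c"
    unfolding c using \<open>0 < p\<close> \<open>p < 1\<close> by (rule quantile_chi_squared_pos)
  define thr where "thr = \<epsilon>\<^sup>2 / c"
  have thr: "0 < thr" "c / \<epsilon>\<^sup>2 = 1 / thr"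
    using c0 \<open>\<epsilon> > 0\<close> by (simp_all add: thr_def)
  obtain A :: "real^'n^'n" where A: "S = A ** transpose A"
    using signal by (auto simp: normal_vector_def)
  have sym: "transpose S = S"
    unfolding A by (rule transpose_transpose_mult_self)
  have lam: "nonzero_eigenvalues_with_mult S k lam" by fact
  have pos: "0 < lam i" if "i \<in> {1..k}" for i
    using nonzero_eigenvalue_of_psd_pos lam that unfolding A by blast
  then have nonzero: "{i \<in> {1..k}. lam i \<noteq> 0} = {1..k}"
    by force
  have dirs: "ig_directions \<sigma> thr S d"
    using directions by (simp add: thr_def)
  \<comment> \<open>The cut-off matters at \<open>l = 0\<close>: there \<open>1 / l\<close> is 0 by
    convention, and for \<sigma> > 0 the bare formula would charge measurements to a zero
    eigenvalue.\<close>
  define f where "f l = (if l \<le> 0 then 0 else max 0 \<lceil>(1 / thr - 1 / l) * \<sigma>\<^sup>2\<rceil>)" for l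
  define h where "h l = (if thr < l then 1 else 0 :: int)" for l
  have f_drop: "f (l * \<sigma>\<^sup>2 / (l + \<sigma>\<^sup>2)) = f l - 1" if "0 < \<sigma>" "thr < l" for l
  proof -
    have "1 / l < 1 / thr"
      using that thr(1) by (intro divide_strict_left_mono) auto
    then show ?thesis
      using ceiling_measurements_drop[of \<sigma> l "1 / thr"] that thr(1) by (simp add: f_def)
  qed
  have h_drop: "h (l * \<sigma>\<^sup>2 / (l + \<sigma>\<^sup>2)) = h l - 1" if "\<sigma>\<^sup>2 \<le> thr" "thr < l" for l
    using updated_eigenvalue_le[of l \<sigma>] that thr(1) by (simp add: h_def)
  have nonneg: "0 \<le> f l" "0 \<le> h l" for l
    by (simp_all add: f_def h_def)
  have sum_f: "spectral_sum f S = (\<Sum>i\<in>{1..k}. max 0 \<lceil>(1 / thr - 1 / lam i) * \<sigma>\<^sup>2\<rceil>)"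
    using spectral_sum_eq_sum_eigenvalues_with_mult[OF sym lam, of f] pos
    by (fastforce simp: f_def intro!: sum.cong)
  have sum_h: "spectral_sum h S = int (card {i \<in> {1..k}. thr < lam i})"
    using spectral_sum_eq_sum_eigenvalues_with_mult[OF sym lam, of h] thr(1)
    by (simp add: h_def sum.If_cases Int_def)
  \<comment> \<open>Termination needs a count that drops: \<open>f\<close> does so only for \<sigma>
    > 0, whereas \<open>h\<close> covers \<sigma> = 0, where \<sigma>^2 is trivially below the
    threshold.\<close>
  have "\<exists>N. ig_stops_after \<sigma> thr S d N"
  proof (cases "\<sigma> = 0")
    case True
    then have "\<sigma>\<^sup>2 \<le> thr" using thr(1) by simp
    then show ?thesis
      by (intro ig_stops_after_exists[where f = h] sym dirs thr(1) h_drop nonneg(2))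
  next
    case False
    then have "0 < \<sigma>" using \<open>\<sigma> \<ge> 0\<close> by simp
    then show ?thesis
      by (intro ig_stops_after_exists[where f = f] sym dirs thr(1) f_drop nonneg(1))
  qed
  then obtain N where N: "ig_stops_after \<sigma> thr S d N" ..
  let ?e = "\<lambda>\<omega>. x \<omega> - ig_mean \<sigma> \<mu> S d (\<lambda>i. d i \<bullet> (x \<omega> + w i \<omega>)) N"
  \<comment> \<open>Before stopping, the denominator is the top eigenvalue plus \<sigma>^2, and the
    former exceeds the positive threshold; this also covers \<sigma> = 0.\<close>
  have reached: "norm (d i) = 1" "d i \<bullet> (ig_cov \<sigma> S d i *v d i) + \<sigma>\<^sup>2 \<noteq> 0" if "i < N" for i
  proof -
    let ?l = "largest_eigenvalue (ig_cov \<sigma> S d i)"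
    have l: "thr < ?l"
      using N that by (simp add: ig_stops_after_def)
    show unit: "norm (d i) = 1"
      using dirs N that unfolding ig_directions_def ig_stops_after_def by simp
    have "ig_cov \<sigma> S d i *v d i = ?l *\<^sub>R d i"
      using dirs N that unfolding ig_directions_def ig_stops_after_def eigenspace_def by simp
    then have "d i \<bullet> (ig_cov \<sigma> S d i *v d i) + \<sigma>\<^sup>2 = ?l + \<sigma>\<^sup>2"
      using unit by (simp add: dot_square_norm)
    also have "\<dots> > 0"
      using l thr(1) by (intro add_pos_nonneg) auto
    finally show "d i \<bullet> (ig_cov \<sigma> S d i *v d i) + \<sigma>\<^sup>2 \<noteq> 0" by simp
  qed
  obtain B where B: "B ** transpose B = ig_cov \<sigma> S d N" "distr M borel ?e = affine_std_normal 0 B"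
    using ig_error_law[OF signal noise indep reached] by blast
  have [measurable]: "x \<in> borel_measurable M" "w i \<in> borel_measurable M" for i
    using signal noise by (auto simp: normal_vector_def)
  have e: "?e \<in> borel_measurable M"
    by (intro borel_measurable_diff measurable_ig_mean) auto
  have "p \<le> measure (affine_std_normal 0 B) {v. norm v < \<epsilon>}"
  proof (rule measure_affine_std_normal_ball[OF \<open>0 < p\<close> \<open>p < 1\<close> c \<open>\<epsilon> > 0\<close>])
    fix v :: "real^'n"
    have "v \<bullet> (ig_cov \<sigma> S d N *v v) \<le> largest_eigenvalue (ig_cov \<sigma> S d N) * (v \<bullet> v)"
      by (rule quadratic_form_le_largest_eigenvalue[OF transpose_ig_cov[OF sym]])
    also have "\<dots> \<le> \<epsilon>\<^sup>2 / c * (v \<bullet> v)"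
      using N by (intro mult_right_mono) (auto simp: ig_stops_after_def thr_def)
    finally show "v \<bullet> ((B ** transpose B) *v v) \<le> \<epsilon>\<^sup>2 / c * (v \<bullet> v)"
      by (simp add: B(1))
  qed
  also have "{v :: real^'n. norm v < \<epsilon>} = ball 0 \<epsilon>"
    by auto
  also have "measure (affine_std_normal 0 B) (ball 0 \<epsilon>) = measure M (?e -` ball 0 \<epsilon> \<inter> space M)"
    unfolding B(2)[symmetric] by (rule measure_distr[OF e]) simp
  also have "?e -` ball 0 \<epsilon> \<inter> space M = {\<omega> \<in> space M. norm (?e \<omega>) < \<epsilon>}"
    by auto
  finally have "p \<le> measure M {\<omega> \<in> space M. norm (?e \<omega>) < \<epsilon>}" .
  moreover have "int N \<le> spectral_sum f S" if "0 < \<sigma>"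
    by (rule ig_stops_after_le_spectral_sum[where f = f, OF sym dirs thr(1) _ nonneg(1) N])
      (rule f_drop[OF that])
  moreover have "int N \<le> spectral_sum h S" if "\<sigma>\<^sup>2 \<le> thr"
    by (rule ig_stops_after_le_spectral_sum[where f = h, OF sym dirs thr(1) _ nonneg(2) N])
      (rule h_drop[OF that])
  moreover have "spectral_sum f S = spectral_sum h S" if "0 < \<sigma>" "\<sigma>\<^sup>2 \<le> thr"
  proof -
    have "spectral_sum f S = (\<Sum>i\<in>{1..k}. h (lam i))"
      unfolding sum_f h_def
      by (intro sum.cong refl ceiling_measurements_eq_indicator thr(1) that pos)
    also have "\<dots> = spectral_sum h S"
      using spectral_sum_eq_sum_eigenvalues_with_mult[OF sym lam, of h] thr(1) by (simp add: h_def)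
    finally show ?thesis .
  qed
  ultimately show ?thesis
    using N unfolding nonzero thr(2) thr_def[symmetric] sum_f sum_h
    by (intro exI[of _ N]) simp
qed

end
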